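(* Let $X$ be a real Banach space, $V$ a reflexive real Banach space and $Z$ a real Hilbert space, and let $\pi:V\to Z$ be linear and continuous. Let $(F,x_0,K,A,j,f)$ be admissible data with constants $(L_J)_J,L',L'',m,\alpha,\beta$ and, for each $n\in\mathbb{N}$, let $(F_n,x_{0n},K_n,A_n,j_n,f_n)$ be admissible data with constants $(L_{Jn})_J,L'_n,L''_n,m_n,\alpha_n,\beta_n$ (admissibility is defined in the context). Assume that: 1. For all $n\in\mathbb{N}$ and all compact $J\subset I$: $L_{Jn}\le L_J$, $L'_n\le L'$, $L''_n\le L''$, $m_n\ge m$, $\alpha_n\le\alpha$, $\beta_n\le\beta$. 2. For all $n$ there exist $\Gamma_n\ge 0$, $\gamma_n\ge 0$ such that $\|F_n(t,x,u)-F(t,x,u)\|_X\le \Gamma_n(\|x\|_X+\|u\|_V+\gamma_n)$ for all $t\in I$, $x\in X$, $u\in V$; moreover $\Gamma_n\to 0$ and $\{\gamma_n\}$ is bounded. 3. $x_{0n}\to x_0$ in $X$. 4. $\{K_n\}$ converges to $K$ in the sense of Mosco, i.e.: (a) for each $v\in K$ there is a sequence $\{v_n\}$ with $v_n\in K_n$ for all $n\in\mathbb{N}$ and $v_n\to v$ in $V$; (b) for each sequence $\{v_n\}$ such that $v_n\in K_n$ for all $n\in\mathbb{N}$ and $v_n\rightharpoonup v$ in $V$, we have $v\in K$. 5. For all $n$ there exist $\Lambda_n\ge0$, $\lambda_n\ge 0$ such that $\|A_n(x,u)-A(x,u)\|_{V^*}\le \Lambda_n(\|x\|_X+\|u\|_V+\lambda_n)$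 for all $x\in X$, $u\in V$; moreover $\Lambda_n\to0$ and $\{\lambda_n\}$ is bounded. 6. (a) For all $n$ there exist $\tau_n\ge 0$, $\delta_n\ge 0$ such that $j_n(x,u,v_1)-j_n(x,u,v_2)\le[\tau_n+\delta_n(\|x\|_X+\|u\|_V)]\,\|v_1-v_2\|_V$ for all $x\in X$, $u,v_1,v_2\in V$. (b) There exist $\tau_0>0$, $\delta_0>0$ such that $\tau_n\le\tau_0$ and $\delta_n\le\delta_0<m$ for all $n$. (c) For any sequences $\{u_n\},\{v_n\}\subset V$ with $u_n\rightharpoonup u$ and $v_n\rightharpoonup v$ in $V$, one has $\limsup_{n\to\infty}[j_n(x,u_n,v_n)-j_n(x,u_n,u_n)]\le j(x,u,v)-j(x,u,u)$ for all $x\in X$. 7. (a) $f_n(t)\rightharpoonup f(t)$ in $Z$ for all $t\in I$. (b) For any compact $J\subset I$ there exists $w_J>0$ with $\|f_n(t)\|_Z\le w_J$ for all $n\in\mathbb{N}$, $t\in J$. 8. For any sequence $\{v_n\}\subset V$ with $v_n\rightharpoonup v$ in $V$, one has $\pi v_n\to\pi v$ in $Z$. Let $(x,u)\in C^1(I;X)\times C(I;V)$ be the solution of Problem $\mathcal{P}$ for the data $(F,x_0,K,A,j,f)$ and $(x_n,u_n)\in C^1(I;X)\times C(I;V)$ the solution of Problem $\mathcal{P}$ for the data $(F_n,x_{0n},K_n,A_n,j_n,f_n)$. Then, for each $t\in I$, $$u_n(t)\to u(t)\ \text{ in } V\quad\text{and}\quad x_n(t)\to x(t)\ \text{ in } X\qquad\text{as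 } n\to\infty.$$
   Context: $I$ denotes either $[0,T]$ with $T>0$ or $[0,+\infty)$. $V^*$ is the topological dual of $V$, $\langle\cdot,\cdot\rangle$ the duality pairing, $(\cdot,\cdot)_Z$ the inner product of $Z$; $\to$ and $\rightharpoonup$ denote strong and weak convergence. Problem $\mathcal{P}$ for data $(F,x_0,K,A,j,f)$, where $F:I\times X\times V\to X$, $x_0\in X$, $K\subset V$, $A:X\times V\to V^*$, $j:X\times V\times V\to\mathbb{R}$, $f:I\to Z$: find $x\in C^1(I;X)$ and $u\in C(I;V)$ such that $\dot x(t)=F(t,x(t),u(t))$ for all $t\in I$, $x(0)=x_0$, and for all $t\in I$: $u(t)\in K$ and $$\langle A(x(t),u(t)),v-u(t)\rangle+j(x(t),u(t),v)-j(x(t),u(t),u(t))\ge (f(t),\pi v-\pi u(t))_Z\quad\forall v\in K.$$ The data $(F,x_0,K,A,j,f)$ are called admissible with constants $(L_J)_J$ (one for each compact $J\subset I$), $L',L'',m,\alpha,\beta$, all positive, if: - $t\mapsto F(t,x,u)$ is continuous for all $x\in X$, $u\in V$, and for every compact $J\subset I$, $\|F(t,x_1,u_1)-F(t,x_2,u_2)\|_X\le L_J(\|x_1-x_2\|_X+\|u_1-u_2\|_V)$ for all $x_1,x_2\in X$, $u_1,u_2\in V$, $t\in J$; - $x_0\in X$; $K$ is a nonempty closed convex subset of $V$; - $\|A(x_1,u)-A(x_2,u)\|_{V^*}\le L'\|x_1-x_2\|_X$, $\|A(x,u_1)-A(x,u_2)\|_{V^*}\le L''\|u_1-u_2\|_V$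 and $\langle A(x,u_1)-A(x,u_2),u_1-u_2\rangle\ge m\|u_1-u_2\|_V^2$ for all $x,x_1,x_2\in X$, $u,u_1,u_2\in V$; - $j(x,u,\cdot)$ is convex and lower semicontinuous on $V$ for all $x\in X$, $u\in V$, and $j(x_1,u_1,v_2)-j(x_1,u_1,v_1)+j(x_2,u_2,v_1)-j(x_2,u_2,v_2)\le\alpha\|x_1-x_2\|_X\|v_1-v_2\|_V+\beta\|u_1-u_2\|_V\|v_1-v_2\|_V$ for all $x_1,x_2\in X$, $u_1,u_2,v_1,v_2\in V$; - $m>\beta$; $f\in C(I;Z)$. For admissible data (with $V$ reflexive and $\pi$ linear continuous) it is known that Problem $\mathcal{P}$ has a unique solution.
   Formalization: Condition 4(b) is taken in Mosco's standard form, for weakly convergent sequences with terms in any subsequence of the sets K_n; with full sequences only, the claim fails (on the real line, K_n alternating between [0,1] and {0}, K={0}, A(x,u)=u, j=0, f=1). *)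

theory Defs
  imports "HOL-Analysis.Analysis"
begin

text \<open>
  Banach spaces are types of class \<open>banach\<close>, a Hilbert space is a type of sort
  \<open>{real_inner, complete_space}\<close>, and the topological dual of \<open>'v\<close> is
  \<open>'v \<Rightarrow>\<^sub>L real\<close> with the operator norm, so that the duality pairing is
  application of a bounded linear function. Functions on \<open>I\<close> are total functions on
  \<open>real\<close> of which only the values on \<open>I\<close> are used.
\<close>

definition time_interval :: "real set \<Rightarrow> bool" where
  "time_interval I \<longleftrightarrow> I = {0..} \<or> (\<exists>T>0. I = {0..T})"

text \<open>Surjectivity of the canonical embedding into the bidual.\<close>

definition reflexive_space :: "'v::real_normed_vector itself \<Rightarrow> bool" where
  "reflexive_space _ \<longleftrightarrow>
     (\<forall>\<phi> :: ('v \<Rightarrow>\<^sub>L real) \<Rightarrow>\<^sub>L real. \<exists>v. \<forall>g. blinfun_apply \<phi> g = blinfun_apply g v)"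

definition weakly_converges :: "(nat \<Rightarrow> 'v::real_normed_vector) \<Rightarrow> 'v \<Rightarrow> bool"
    (infix "\<rightharpoonup>" 55) where
  "s \<rightharpoonup> v \<longleftrightarrow>
     (\<forall>g :: 'v \<Rightarrow>\<^sub>L real. (\<lambda>n. blinfun_apply g (s n)) \<longlonglongrightarrow> blinfun_apply g v)"

definition lower_semicont :: "('v::topological_space \<Rightarrow> real) \<Rightarrow> bool" where
  "lower_semicont g \<longleftrightarrow> (\<forall>v c. c < g v \<longrightarrow> (\<forall>\<^sub>F w in nhds v. c < g w))"

text \<open>
  The second condition ranges over subsequences of the sets, as in Mosco's definition: the weak upper
  limit of the sets lies in the limit set. Without subsequences, sets that alternate between \<open>{0}\<close>
  and \<open>{0..1}\<close> on the real line would converge to \<open>{0}\<close>, although for \<open>F = 0\<close>, \<open>A (x, u) = u\<close>,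
  \<open>j = 0\<close>, \<open>f = 1\<close> the solutions \<open>u\<close> of the inequality alternate between 0 and 1.
\<close>

definition mosco_converges :: "(nat \<Rightarrow> 'v::real_normed_vector set) \<Rightarrow> 'v set \<Rightarrow> bool" where
  "mosco_converges Kn K \<longleftrightarrow>
     (\<forall>v\<in>K. \<exists>w. (\<forall>n. w n \<in> Kn n) \<and> w \<longlonglongrightarrow> v) \<and>
     (\<forall>r w v. strict_mono (r :: nat \<Rightarrow> nat) \<and> (\<forall>k. w k \<in> Kn (r k)) \<and> w \<rightharpoonup> v
        \<longrightarrow> v \<in> K)"

text \<open>One-sided derivatives at the end points of \<open>I\<close>.\<close>

definition C1_on :: "real set \<Rightarrow> (real \<Rightarrow> 'x::real_normed_vector) \<Rightarrow> bool" where
  "C1_on I x \<longleftrightarrow>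
     (\<exists>x'. (\<forall>t\<in>I. (x has_vector_derivative x' t) (at t within I)) \<and> continuous_on I x')"

definition solves_P ::
    "real set \<Rightarrow> ('v::real_normed_vector \<Rightarrow> 'z::real_inner) \<Rightarrow>
     (real \<Rightarrow> 'x::real_normed_vector \<Rightarrow> 'v \<Rightarrow> 'x) \<Rightarrow> 'x \<Rightarrow> 'v set \<Rightarrow>
     ('x \<Rightarrow> 'v \<Rightarrow> 'v \<Rightarrow>\<^sub>L real) \<Rightarrow> ('x \<Rightarrow> 'v \<Rightarrow> 'v \<Rightarrow> real) \<Rightarrow> (real \<Rightarrow> 'z) \<Rightarrow>
     (real \<Rightarrow> 'x) \<Rightarrow> (real \<Rightarrow> 'v) \<Rightarrow> bool" where
  "solves_P I \<pi> F x0 K A j f x u \<longleftrightarrow>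
     C1_on I x \<and> continuous_on I u \<and>
     (\<forall>t\<in>I. (x has_vector_derivative F t (x t) (u t)) (at t within I)) \<and>
     x 0 = x0 \<and>
     (\<forall>t\<in>I. u t \<in> K \<and>
        (\<forall>v\<in>K. blinfun_apply (A (x t) (u t)) (v - u t) + j (x t) (u t) v - j (x t) (u t) (u t)
               \<ge> inner (f t) (\<pi> v - \<pi> (u t))))"

text \<open>\<open>L J\<close> matters only for compact \<open>J \<subseteq> I\<close>.\<close>

definition admissible ::
    "real set \<Rightarrow> (real \<Rightarrow> 'x::real_normed_vector \<Rightarrow> 'v::real_normed_vector \<Rightarrow> 'x) \<Rightarrow> 'v set \<Rightarrow>
     ('x \<Rightarrow> 'v \<Rightarrow> 'v \<Rightarrow>\<^sub>L real) \<Rightarrow> ('x \<Rightarrow> 'v \<Rightarrow> 'v \<Rightarrow> real) \<Rightarrow> (real \<Rightarrow> 'z::real_inner) \<Rightarrow>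
     (real set \<Rightarrow> real) \<Rightarrow> real \<Rightarrow> real \<Rightarrow> real \<Rightarrow> real \<Rightarrow> real \<Rightarrow> bool" where
  "admissible I F K A j f L L' L'' m \<alpha> \<beta> \<longleftrightarrow>
     (\<forall>J. compact J \<and> J \<subseteq> I \<longrightarrow> 0 < L J) \<and>
     0 < L' \<and> 0 < L'' \<and> 0 < m \<and> 0 < \<alpha> \<and> 0 < \<beta> \<and>
     (\<forall>x u. continuous_on I (\<lambda>t. F t x u)) \<and>
     (\<forall>J. compact J \<and> J \<subseteq> I \<longrightarrow>
        (\<forall>x1 x2 u1 u2. \<forall>t\<in>J.
           norm (F t x1 u1 - F t x2 u2) \<le> L J * (norm (x1 - x2) + norm (u1 - u2)))) \<and>
     K \<noteq> {} \<and> closed K \<and> convex K \<and>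
     (\<forall>x1 x2 u. norm (A x1 u - A x2 u) \<le> L' * norm (x1 - x2)) \<and>
     (\<forall>x u1 u2. norm (A x u1 - A x u2) \<le> L'' * norm (u1 - u2)) \<and>
     (\<forall>x u1 u2. blinfun_apply (A x u1 - A x u2) (u1 - u2) \<ge> m * (norm (u1 - u2))\<^sup>2) \<and>
     (\<forall>x u. convex_on UNIV (j x u) \<and> lower_semicont (j x u)) \<and>
     (\<forall>x1 x2 u1 u2 v1 v2.
        j x1 u1 v2 - j x1 u1 v1 + j x2 u2 v1 - j x2 u2 v2
          \<le> \<alpha> * norm (x1 - x2) * norm (v1 - v2) + \<beta> * norm (u1 - u2) * norm (v1 - v2)) \<and>
     m > \<beta> \<and> continuous_on I f"

end

theory Submission
  imports Defs "HOL-Complex_Analysis.Great_Picard"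
begin

text \<open>
  The state equation is stable by Gronwall's inequality as soon as the error \<open>u\<^sub>n(t) - u(t)\<close> of the
  control is dominated by the error of the state. The heart of the proof is therefore the estimate, at
  each fixed time \<open>t\<close>,
  \<open>\<parallel>u\<^sub>n(t) - u(t)\<parallel> \<le> D \<parallel>x\<^sub>n(t) - x(t)\<parallel> + \<epsilon>\<^sub>n(t)\<close> with \<open>D = (L' + \<alpha>) / (m - \<beta>)\<close> and \<open>\<epsilon>\<^sub>n(t) \<rightarrow> 0\<close>
  (\<open>variational_inequality_stability\<close>). It holds for any bounded states, and it compares
  the two solutions directly, instead of through an auxiliary variational inequality with \<open>x\<close> in place
  of \<open>x\<^sub>n\<close>.

  The estimate is a compactness argument. If it failed, a subsequence of \<open>u\<^sub>n(t)\<close> would violate it and,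
  by reflexivity, converge weakly to some \<open>w\<close>, which lies in \<open>K\<close> by Mosco convergence. Strong
  monotonicity, tested with some \<open>v\<^sub>n \<in> K\<^sub>n\<close> converging to \<open>u\<close>, bounds \<open>m \<parallel>u\<^sub>n - v\<^sub>n\<parallel>\<^sup>2\<close> by terms that all
  pass to the limit: the operators converge strongly at \<open>v\<^sub>n\<close>, \<open>\<pi>\<close> turns weak into strong convergence, and
  the functionals obey the upper-limit condition. The variational inequality for \<open>u\<close>, tested with \<open>w\<close>,
  then leaves \<open>m d\<^sup>2 \<le> (L' + \<alpha>) c d + \<beta> \<parallel>u - w\<parallel>\<^sup>2\<close>, where \<open>d\<close> and \<open>c\<close> are the limits of the two errors, and
  weak lower semicontinuity of the norm gives \<open>\<parallel>u - w\<parallel> \<le> d\<close>. Hence \<open>(m - \<beta>) d \<le> (L' + \<alpha>) c\<close>, a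
  contradiction.

  Two ingredients surround this. Testing with a bounded sequence \<open>v\<^sub>n \<in> K\<^sub>n\<close> bounds the controls affinely by
  the states (\<open>variational_inequality_a_priori\<close>, where \<open>\<delta>\<^sub>0 < m\<close> enters), so that Gronwall's inequality
  (\<open>gronwall_norm_bound\<close>) bounds both on compact time intervals. These bounds also dominate \<open>\<epsilon>\<^sub>n\<close>, so its
  integral tends to 0, and a second application of Gronwall's inequality yields \<open>x\<^sub>n(t) \<rightarrow> x(t)\<close>; the
  estimate at time \<open>t\<close> then yields \<open>u\<^sub>n(t) \<rightarrow> u(t)\<close>.

  The functional analysis behind the compactness argument is developed from the Hahn-Banach theorem:
  bounded sequences in a reflexive space have weakly convergent subsequences
  (\<open>reflexive_weak_subsequence\<close>).
\<close>

section \<open>Linear functionals below a sublinear functional\<close>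

definition sublinear :: "('a::real_vector \<Rightarrow> real) \<Rightarrow> bool" where
  "sublinear p \<longleftrightarrow> (\<forall>x y. p (x + y) \<le> p x + p y) \<and> (\<forall>c\<ge>0. \<forall>x. p (c *\<^sub>R x) = c * p x)"

text \<open>
  The inequality \<open>p (c x) \<le> c p x\<close> for \<open>c > 0\<close> is enough, since applying it to \<open>1 / c\<close> gives the converse.
\<close>

lemma sublinearI:
  assumes add: "\<And>x y. p (x + y) \<le> p x + p y"
    and zero: "p 0 = 0"
    and scale: "\<And>c x. c > 0 \<Longrightarrow> p (c *\<^sub>R x) \<le> c * p x"
  shows "sublinear p"
proof -
  have "p (c *\<^sub>R x) = c * p x" if "c > 0" for c x
  proof (rule antisym)
    have "p (inverse c *\<^sub>R (c *\<^sub>R x)) \<le> inverse c * p (c *\<^sub>R x)"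
      using scale[of "inverse c" "c *\<^sub>R x"] that by simp
    then show "c * p x \<le> p (c *\<^sub>R x)"
      using that by (simp add: field_simps)
  qed (rule scale[OF that])
  then show ?thesis
    unfolding sublinear_def using add zero by (metis less_eq_real_def mult_zero_left scaleR_zero_left)
qed

lemma sublinear_add: "sublinear p \<Longrightarrow> p (x + y) \<le> p x + p y"
  and sublinear_scale: "sublinear p \<Longrightarrow> c \<ge> 0 \<Longrightarrow> p (c *\<^sub>R x) = c * p x"
  by (simp_all add: sublinear_def)

lemma sublinear_zero: "sublinear p \<Longrightarrow> p 0 = 0"
  using sublinear_scale[of p 0 0] by simp

lemma sublinear_lower: "sublinear p \<Longrightarrow> - p (- x) \<le> p x"
  using sublinear_add[of p x "- x"] sublinear_zero[of p] by simp

text \<open>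
  Any sublinear functional can be lowered until it is odd at a given \<open>y\<close>: the new functional is
  \<open>x \<mapsto> inf {p (x + t y) - t p y | t \<ge> 0}\<close>, and taking \<open>t = 1\<close> at \<open>x = - y\<close> gives the last bound. The
  infimum is finite because \<open>t p y = p (t y) \<le> p (x + t y) + p (- x)\<close>.
\<close>

lemma sublinear_lower_directional:
  assumes p: "sublinear p"
  obtains q where "sublinear q" "q \<le> p" "q (- y) \<le> - p y"
proof
  define q where "q = (\<lambda>x. INF t\<in>{0..}. p (x + t *\<^sub>R y) - t * p y)"
  have low: "- p (- x) \<le> p (x + t *\<^sub>R y) - t * p y" if "t \<ge> 0" for t x
    using sublinear_add[OF p, of "x + t *\<^sub>R y" "- x"] sublinear_scale[OF p that, of y] by simp
  then have bdd: "bdd_below ((\<lambda>t. p (x + t *\<^sub>R y) - t * p y) ` {0..})" for x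
    by (intro bdd_belowI[of _ "- p (- x)"]) auto
  have le: "q x \<le> p (x + t *\<^sub>R y) - t * p y" if "t \<ge> 0" for t x
    unfolding q_def by (rule cINF_lower[OF bdd]) (use that in auto)
  have ge: "c \<le> q x" if "\<And>t. t \<ge> 0 \<Longrightarrow> c \<le> p (x + t *\<^sub>R y) - t * p y" for c x
    unfolding q_def by (rule cINF_greatest) (use that in auto)
  show "q \<le> p"
    using le[of 0] by (auto simp: le_fun_def)
  show "q (- y) \<le> - p y"
    using le[of 1 "- y"] sublinear_zero[OF p] by simp
  show "sublinear q"
  proof (rule sublinearI)
    fix x1 x2
    have "q (x1 + x2) - (p (x2 + t *\<^sub>R y) - t * p y) \<le> q x1" if t: "t \<ge> 0" for t
    proof (rule ge)
      fix s :: real assume s: "s \<ge> 0"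
      have "q (x1 + x2) \<le> p ((x1 + s *\<^sub>R y) + (x2 + t *\<^sub>R y)) - (s + t) * p y"
        using le[of "s + t" "x1 + x2"] s t by (simp add: algebra_simps)
      with sublinear_add[OF p, of "x1 + s *\<^sub>R y" "x2 + t *\<^sub>R y"]
      show "q (x1 + x2) - (p (x2 + t *\<^sub>R y) - t * p y) \<le> p (x1 + s *\<^sub>R y) - s * p y"
        by (simp add: algebra_simps)
    qed
    then have "q (x1 + x2) - q x1 \<le> q x2"
      by (intro ge) (simp add: algebra_simps)
    then show "q (x1 + x2) \<le> q x1 + q x2" by simp
  next
    show "q 0 = 0"
    proof (rule antisym)
      show "q 0 \<le> 0" using le[of 0 0] sublinear_zero[OF p] by simp
      show "0 \<le> q 0" by (rule ge) (simp add: sublinear_scale[OF p])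
    qed
  next
    fix c :: real and x assume c: "c > 0"
    have "q (c *\<^sub>R x) / c \<le> q x"
    proof (rule ge)
      fix t :: real assume t: "t \<ge> 0"
      have "q (c *\<^sub>R x) \<le> p (c *\<^sub>R (x + t *\<^sub>R y)) - (c * t) * p y"
        using le[of "c * t" "c *\<^sub>R x"] c t by (simp add: algebra_simps)
      also have "\<dots> = c * (p (x + t *\<^sub>R y) - t * p y)"
        using sublinear_scale[OF p, of c "x + t *\<^sub>R y"] c by (simp add: algebra_simps)
      finally show "q (c *\<^sub>R x) / c \<le> p (x + t *\<^sub>R y) - t * p y"
        using c by (simp add: field_simps)
    qed
    then show "q (c *\<^sub>R x) \<le> c * q x" using c by (simp add: field_simps)
  qed
qed

text \<open>
  The pointwise infimum of a chain is finite since \<open>q x \<ge> - q (- x) \<ge> - p (- x)\<close> for every member \<open>q\<close>. This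
  is what Zorn's lemma needs.
\<close>

lemma sublinear_chain_Inf:
  fixes C :: "('a::real_vector \<Rightarrow> real) set"
  assumes ne: "C \<noteq> {}" and sub: "\<And>q. q \<in> C \<Longrightarrow> sublinear q \<and> q \<le> p"
    and chain: "\<And>q r. q \<in> C \<Longrightarrow> r \<in> C \<Longrightarrow> q \<le> r \<or> r \<le> q"
  obtains q0 where "sublinear q0" "\<And>q. q \<in> C \<Longrightarrow> q0 \<le> q"
proof
  define q0 where "q0 = (\<lambda>x. INF q\<in>C. q x)"
  have "- p (- x) \<le> q x" if "q \<in> C" for q x
    using sublinear_lower[of q x] sub[OF that] le_funD[of q p "- x"] by linarith
  then have bdd: "bdd_below ((\<lambda>q. q x) ` C)" for x
    by (intro bdd_belowI[of _ "- p (- x)"]) auto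
  have le: "q0 x \<le> q x" if "q \<in> C" for q x
    unfolding q0_def by (rule cINF_lower[OF bdd that])
  have ge: "c \<le> q0 x" if "\<And>q. q \<in> C \<Longrightarrow> c \<le> q x" for c x
    unfolding q0_def by (rule cINF_greatest[OF ne that])
  show "\<And>q. q \<in> C \<Longrightarrow> q0 \<le> q"
    using le by (auto simp: le_fun_def)
  show "sublinear q0"
  proof (rule sublinearI)
    fix x y
    have "q0 (x + y) - r y \<le> q0 x" if r: "r \<in> C" for r
    proof (rule ge)
      fix q assume q: "q \<in> C"
      \<comment> \<open>The smaller of the two functionals is subadditive and bounds the infimum.\<close>
      obtain s where s: "s \<in> C" "s \<le> q" "s \<le> r" using chain[OF q r] q r by auto
      have "q0 (x + y) \<le> s x + s y"
        using le[OF s(1), of "x + y"] sublinear_add[of s x y] sub[OF s(1)] by linarith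
      then show "q0 (x + y) - r y \<le> q x"
        using le_funD[OF s(2), of x] le_funD[OF s(3), of y] by linarith
    qed
    then have "q0 (x + y) - q0 x \<le> q0 y"
      by (intro ge) (simp add: algebra_simps)
    then show "q0 (x + y) \<le> q0 x + q0 y" by simp
  next
    obtain q where "q \<in> C" using ne by auto
    then show "q0 0 = 0"
      using le[of q 0] ge[of 0 0] sub by (fastforce simp: sublinear_zero intro: antisym)
  next
    fix c :: real and x assume c: "c > 0"
    have "q0 (c *\<^sub>R x) / c \<le> q0 x"
    proof (rule ge)
      fix q assume q: "q \<in> C"
      show "q0 (c *\<^sub>R x) / c \<le> q x"
        using le[OF q, of "c *\<^sub>R x"] sublinear_scale[of q c x] sub[OF q] c by (simp add: field_simps)
    qed
    then show "q0 (c *\<^sub>R x) \<le> c * q0 x" using c by (simp add: field_simps)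
  qed
qed

text \<open>
  A minimal functional cannot be lowered at any point, so it is odd, and an odd subadditive functional
  is additive.
\<close>

lemma minimal_sublinear_linear:
  assumes m: "sublinear m" and min: "\<And>q. sublinear q \<Longrightarrow> q \<le> m \<Longrightarrow> q = m"
  shows "linear m"
proof -
  have neg: "m (- y) = - m y" for y
  proof (rule antisym)
    obtain q where "sublinear q" "q \<le> m" "q (- y) \<le> - m y"
      using sublinear_lower_directional[OF m] .
    then show "m (- y) \<le> - m y" using min by blast
    show "- m y \<le> m (- y)" using sublinear_lower[OF m, of "- y"] by simp
  qed
  have add: "m (x + y) = m x + m y" for x y
    using sublinear_add[OF m, of x y] sublinear_add[OF m, of "x + y" "- y"] neg[of y] by simp
  moreover have "m (c *\<^sub>R x) = c *\<^sub>R m x" for c x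
    using sublinear_scale[OF m, of c x] sublinear_scale[OF m, of "- c" x] neg[of "c *\<^sub>R x"]
    by (cases "c \<ge> 0") auto
  ultimately show ?thesis by (intro linearI) auto
qed

text \<open>
  The Hahn-Banach theorem without partial functionals: a minimal sublinear functional below \<open>p\<close> is
  already linear. To keep the value at \<open>y\<close>, \<open>p\<close> is first lowered in the direction \<open>y\<close>, which forces
  \<open>g (- y) \<le> - p y\<close>.
\<close>

theorem hahn_banach_sublinear:
  fixes p :: "'a::real_vector \<Rightarrow> real"
  assumes p: "sublinear p"
  obtains g where "linear g" "\<And>x. g x \<le> p x" "g y = p y"
proof -
  obtain p1 where p1: "sublinear p1" "p1 \<le> p" "p1 (- y) \<le> - p y"
    using sublinear_lower_directional[OF p] .
  define S where "S = {q. sublinear q \<and> q \<le> p1}"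
  have "\<exists>m\<in>S. \<forall>q\<in>S. m \<ge> q \<longrightarrow> q = m"
  proof (rule predicate_Zorn)
    show "partial_order_on S (relation_of (\<lambda>q r. q \<ge> r) S)"
      by (auto simp: partial_order_on_def preorder_on_def refl_on_def trans_def antisym_def relation_of_def)
  next
    fix C assume C: "C \<in> Chains (relation_of (\<lambda>q r. q \<ge> r) S)"
    show "\<exists>u\<in>S. \<forall>a\<in>C. a \<ge> u"
    proof (cases "C = {}")
      case True
      then show ?thesis using p1(1) by (auto simp: S_def)
    next
      case False
      have CS: "sublinear q \<and> q \<le> p1" if "q \<in> C" for q
        using C that by (auto simp: Chains_def relation_of_def S_def)
      moreover have "q \<le> r \<or> r \<le> q" if "q \<in> C" "r \<in> C" for q r
        using C that by (auto simp: Chains_def relation_of_def)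
      ultimately obtain q0 where q0: "sublinear q0" "\<And>q. q \<in> C \<Longrightarrow> q0 \<le> q"
        using sublinear_chain_Inf[OF False, of p1] by metis
      moreover obtain q where "q \<in> C" using False by auto
      ultimately have "q0 \<in> S"
        using CS by (auto simp: S_def intro: order_trans)
      with q0 show ?thesis by blast
    qed
  qed
  then obtain g where g: "sublinear g" "g \<le> p1"
    and min: "\<And>q. sublinear q \<Longrightarrow> q \<le> g \<Longrightarrow> q = g"
    unfolding S_def by (auto intro: order_trans)
  have lin: "linear g" by (rule minimal_sublinear_linear[OF g(1) min])
  have le: "g x \<le> p x" for x
    using le_funD[OF g(2)] le_funD[OF p1(2)] by (meson order_trans)
  have "p y \<le> g y"
    using le_funD[OF g(2), of "- y"] p1(3) linear_neg[OF lin, of y] by simp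
  with lin le show ?thesis using that by (meson antisym)
qed

corollary hahn_banach_blinfun:
  fixes p :: "'a::real_normed_vector \<Rightarrow> real"
  assumes p: "sublinear p" and bound: "\<And>x. p x \<le> M * norm x"
  obtains g :: "'a \<Rightarrow>\<^sub>L real" where "\<And>x. g x \<le> p x" "g y = p y"
proof -
  obtain g where g: "linear g" "\<And>x. g x \<le> p x" "g y = p y"
    by (rule hahn_banach_sublinear[OF p, where y = y]) blast
  have "norm (g x) \<le> norm x * M" for x
    using g(2)[of x] g(2)[of "- x"] bound[of x] bound[of "- x"] linear_neg[OF g(1), of x]
    by (simp add: mult.commute)
  then have "bounded_linear g"
    using g(1) by (intro bounded_linear_intro[where K = M]) (auto simp: linear_add linear_scale)
  then show ?thesis
    using that[of "Blinfun g"] g by (simp add: bounded_linear_Blinfun_apply)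
qed

lemma norming_functional:
  fixes y :: "'a::real_normed_vector"
  obtains g :: "'a \<Rightarrow>\<^sub>L real" where "\<And>x. \<bar>g x\<bar> \<le> norm x" "g y = norm y"
proof -
  have "sublinear (norm :: 'a \<Rightarrow> real)"
    by (simp add: sublinear_def norm_triangle_ineq)
  then obtain g :: "'a \<Rightarrow>\<^sub>L real" where g: "\<And>x. g x \<le> norm x" "g y = norm y"
    by (rule hahn_banach_blinfun[where M = 1]) auto
  have "\<bar>g x\<bar> \<le> norm x" for x
    using g(1)[of x] g(1)[of "- x"] by (simp add: blinfun.minus_right)
  then show ?thesis using that g(2) by blast
qed

text \<open>
  The distance to a subspace is sublinear, and it vanishes exactly on the closure.
\<close>

lemma subspace_separation:
  fixes S :: "'a::real_normed_vector set"
  assumes S: "subspace S" and y: "y \<notin> closure S"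
  obtains g :: "'a \<Rightarrow>\<^sub>L real" where "\<And>s. s \<in> S \<Longrightarrow> g s = 0" "g y \<noteq> 0"
proof -
  have ne: "S \<noteq> {}" using subspace_0[OF S] by auto
  have le: "infdist x S \<le> norm (x - s)" if "s \<in> S" for x s
    using infdist_le[OF that, of x] by (simp add: dist_norm)
  have ge: "c \<le> infdist x S" if "\<And>s. s \<in> S \<Longrightarrow> c \<le> norm (x - s)" for c x
    unfolding infdist_def using ne that by (auto simp: dist_norm intro!: cINF_greatest)
  have "sublinear (\<lambda>x. infdist x S)"
  proof (rule sublinearI)
    fix x1 x2
    have "infdist (x1 + x2) S - norm (x2 - t) \<le> infdist x1 S" if t: "t \<in> S" for t
    proof (rule ge)
      fix s assume s: "s \<in> S"
      have "infdist (x1 + x2) S \<le> norm ((x1 - s) + (x2 - t))"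
        using le[of "s + t" "x1 + x2"] subspace_add[OF S s t] by (simp add: algebra_simps)
      then show "infdist (x1 + x2) S - norm (x2 - t) \<le> norm (x1 - s)"
        using norm_triangle_ineq[of "x1 - s" "x2 - t"] by linarith
    qed
    then have "infdist (x1 + x2) S - infdist x1 S \<le> infdist x2 S"
      by (intro ge) (simp add: algebra_simps)
    then show "infdist (x1 + x2) S \<le> infdist x1 S + infdist x2 S" by simp
  next
    show "infdist 0 S = 0" using subspace_0[OF S] by simp
  next
    fix c :: real and x assume c: "c > 0"
    have "infdist (c *\<^sub>R x) S / c \<le> infdist x S"
    proof (rule ge)
      fix s assume "s \<in> S"
      then have "infdist (c *\<^sub>R x) S \<le> norm (c *\<^sub>R (x - s))"
        using le[of "c *\<^sub>R s" "c *\<^sub>R x"] subspace_scale[OF S] by (simp add: algebra_simps)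
      then have "infdist (c *\<^sub>R x) S \<le> c * norm (x - s)" using c by simp
      then show "infdist (c *\<^sub>R x) S / c \<le> norm (x - s)" using c by (simp add: divide_le_eq mult.commute)
    qed
    then show "infdist (c *\<^sub>R x) S \<le> c * infdist x S" using c by (simp add: field_simps)
  qed
  then obtain g :: "'a \<Rightarrow>\<^sub>L real" where g: "\<And>x. g x \<le> infdist x S" "g y = infdist y S"
    by (rule hahn_banach_blinfun[where M = 1]) (use le[OF subspace_0[OF S]] in auto)
  show ?thesis
  proof (rule that)
    show "g s = 0" if "s \<in> S" for s
      using g(1)[of s] g(1)[of "- s"] subspace_neg[OF S that] that by (simp add: blinfun.minus_right)
    show "g y \<noteq> 0"
      using g(2) y in_closure_iff_infdist_zero[OF ne] by simp
  qed
qed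

section \<open>Weak sequential compactness in reflexive spaces\<close>

lemma frequently_subsequence:
  assumes "\<exists>\<^sub>F n in sequentially. P n"
  obtains r :: "nat \<Rightarrow> nat" where "strict_mono r" "\<And>k. P (r k)"
  using infinite_enumerate[of "{n. P n}"] assms
  by (auto simp: frequently_cofinite[symmetric] cofinite_eq_sequentially)

lemma weakly_convergesD:
  fixes g :: "'a::real_normed_vector \<Rightarrow>\<^sub>L real"
  shows "s \<rightharpoonup> v \<Longrightarrow> (\<lambda>n. g (s n)) \<longlonglongrightarrow> g v"
  by (simp add: weakly_converges_def)

lemma weakly_converges_subseq: "s \<rightharpoonup> v \<Longrightarrow> strict_mono r \<Longrightarrow> (\<lambda>k. s (r k)) \<rightharpoonup> v"
  unfolding weakly_converges_def using LIMSEQ_subseq_LIMSEQ[unfolded o_def] by blast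

lemma tendsto_imp_weakly_converges: "s \<longlonglongrightarrow> v \<Longrightarrow> s \<rightharpoonup> v"
  unfolding weakly_converges_def using bounded_linear.tendsto[OF blinfun.bounded_linear_right] by blast

lemma weakly_converges_diff:
  assumes "s \<rightharpoonup> v" "s' \<rightharpoonup> v'" shows "(\<lambda>n. s n - s' n) \<rightharpoonup> v - v'"
  using assms by (auto simp: weakly_converges_def blinfun.diff_right intro!: tendsto_diff)

text \<open>
  Weak lower semicontinuity of the norm, tested with a norming functional of the limit.
\<close>

lemma weakly_converges_norm_le:
  assumes s: "s \<rightharpoonup> v" and d: "(\<lambda>n. norm (s n)) \<longlonglongrightarrow> d"
  shows "norm v \<le> d"
proof -
  obtain g :: "'a \<Rightarrow>\<^sub>L real" where g: "\<And>x. \<bar>g x\<bar> \<le> norm x" "g v = norm v"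
    by (rule norming_functional[where y = v]) blast
  have "g v \<le> d"
    by (rule LIMSEQ_le[OF weakly_convergesD[OF s, of g] d]) (use g(1) abs_le_D1 in blast)
  with g(2) show ?thesis by simp
qed

lemma tendsto_blinfun_apply_weak:
  fixes a :: "nat \<Rightarrow> 'a::real_normed_vector \<Rightarrow>\<^sub>L real"
  assumes a: "a \<longlonglongrightarrow> b" and s: "s \<rightharpoonup> v" and bdd: "bounded (range s)"
  shows "(\<lambda>n. a n (s n)) \<longlonglongrightarrow> b v"
proof -
  obtain M where M: "\<And>n. norm (s n) \<le> M" using bdd by (auto simp: bounded_iff)
  have "(\<lambda>n. norm (a n - b) * M) \<longlonglongrightarrow> norm (b - b) * M"
    using a by (intro tendsto_intros)
  then have lim: "(\<lambda>n. norm (a n - b) * M) \<longlonglongrightarrow> 0" by simp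
  have "norm ((a n - b) (s n)) \<le> norm (a n - b) * M" for n
    using M[of n] norm_blinfun[of "a n - b" "s n"] by (meson mult_left_mono norm_ge_zero order_trans)
  then have "(\<lambda>n. (a n - b) (s n)) \<longlonglongrightarrow> 0"
    by (intro Lim_null_comparison[OF always_eventually lim] allI)
  from tendsto_add[OF this weakly_convergesD[OF s, of b]] show ?thesis
    by (simp add: blinfun.diff_left)
qed

lemma tendsto_inner_weak:
  fixes f :: "nat \<Rightarrow> 'z::real_inner"
  assumes f: "f \<rightharpoonup> g" and bdd: "bounded (range f)" and z: "z \<longlonglongrightarrow> y"
  shows "(\<lambda>n. inner (f n) (z n)) \<longlonglongrightarrow> inner g y"
proof -
  have "(\<lambda>n. blinfun_inner_left (z n)) \<longlonglongrightarrow> blinfun_inner_left y"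
    by (rule bounded_linear.tendsto[OF bounded_linear_blinfun_inner_left z])
  from tendsto_blinfun_apply_weak[OF this f bdd] show ?thesis by simp
qed

text \<open>
  The combinations with rational coefficients form the set \<open>D\<close>. It is built up one summand at a time,
  which makes countability immediate.
\<close>

lemma closure_rational_combinations:
  fixes s :: "nat \<Rightarrow> 'a::real_normed_vector"
  obtains D where "countable D" "span (range s) \<subseteq> closure D"
proof -
  define step where "step = (\<lambda>E. (\<lambda>(x, q, i). x + real_of_rat q *\<^sub>R s i) ` (E \<times> UNIV \<times> UNIV))"
  define E where "E = (\<lambda>k. (step ^^ k) {0})"
  define D where "D = (\<Union>k. E k)"
  have "countable (E k)" for k
    by (induction k) (auto simp: E_def step_def)
  then have "countable D" by (simp add: D_def)
  have D0: "0 \<in> D" by (auto simp: D_def E_def intro: exI[of _ 0])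
  have Dstep: "x + real_of_rat q *\<^sub>R s i \<in> D" if x: "x \<in> D" for x q i
  proof -
    obtain k where "x \<in> E k" using x by (auto simp: D_def)
    then have "x + real_of_rat q *\<^sub>R s i \<in> step (E k)"
      unfolding step_def by (intro image_eqI[where x = "(x, q, i)"]) auto
    then have "x + real_of_rat q *\<^sub>R s i \<in> E (Suc k)" by (simp add: E_def)
    then show ?thesis by (auto simp: D_def)
  qed
  have "x \<in> closure D" if "x \<in> span (range s)" for x
    using that
  proof (induction rule: span_induct_alt)
    case base
    then show ?case using D0 closure_subset by blast
  next
    case (step c b y)
    obtain i where b: "b = s i" using step(1) by auto
    have "c \<in> closure \<rat>" by (simp add: Rats_closure_real)
    then obtain q where q: "\<And>n. q n \<in> \<rat>" "q \<longlonglongrightarrow> c"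
      by (auto simp: closure_sequential)
    obtain d where d: "\<And>n. d n \<in> D" "d \<longlonglongrightarrow> y"
      using step(2) by (auto simp: closure_sequential)
    have "d n + q n *\<^sub>R b \<in> D" for n
      using Dstep[OF d(1)] q(1)[of n] by (auto simp: Rats_def b)
    moreover have "(\<lambda>n. d n + q n *\<^sub>R b) \<longlonglongrightarrow> y + c *\<^sub>R b"
      by (intro tendsto_intros q d)
    ultimately show ?case
      unfolding closure_sequential by (auto simp: add.commute intro!: exI[of _ "\<lambda>n. d n + q n *\<^sub>R b"])
  qed
  with \<open>countable D\<close> show ?thesis using that by blast
qed

text \<open>
  A kind of Banach limit. The upper limit of \<open>g (s n)\<close> is a sublinear functional of \<open>g\<close>, written here as the
  infimum of the eventual upper bounds; any linear functional below it on the dual space is bounded and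
  agrees with the limit wherever one exists. By reflexivity it is evaluation at a point.
\<close>

lemma reflexive_generalised_limit:
  fixes s :: "nat \<Rightarrow> 'v::real_normed_vector"
  assumes refl: "reflexive_space TYPE('v)" and bdd: "bounded (range s)"
  obtains w where "\<And>(g :: 'v \<Rightarrow>\<^sub>L real) l. (\<lambda>n. blinfun_apply g (s n)) \<longlonglongrightarrow> l \<Longrightarrow> blinfun_apply g w = l"
proof -
  obtain M where M: "\<And>n. norm (s n) \<le> M" using bdd by (auto simp: bounded_iff)
  define p where "p = (\<lambda>g :: 'v \<Rightarrow>\<^sub>L real. Inf {c. \<forall>\<^sub>F n in sequentially. blinfun_apply g (s n) \<le> c})"
  have abs: "\<bar>blinfun_apply g (s n)\<bar> \<le> M * norm g" for g n
    using norm_blinfun[of g "s n"] mult_left_mono[OF M[of n], of "norm g"]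
    by (simp add: mult.commute)
  have low: "- (M * norm g) \<le> c" if c: "\<forall>\<^sub>F n in sequentially. blinfun_apply g (s n) \<le> c" for g c
  proof -
    obtain n where "blinfun_apply g (s n) \<le> c"
      using eventually_happens'[OF sequentially_bot c] by blast
    then show ?thesis using abs[of g n] by linarith
  qed
  have le: "p g \<le> c" if "\<forall>\<^sub>F n in sequentially. blinfun_apply g (s n) \<le> c" for g c
    unfolding p_def by (rule cInf_lower) (use that low in \<open>auto intro!: bdd_belowI[of _ "- (M * norm g)"]\<close>)
  have top: "\<forall>\<^sub>F n in sequentially. blinfun_apply g (s n) \<le> M * norm g" for g
    by (rule always_eventually) (use abs abs_le_D1 in blast)
  have ge: "c \<le> p g" if "\<And>d. \<forall>\<^sub>F n in sequentially. blinfun_apply g (s n) \<le> d \<Longrightarrow> c \<le> d" for g c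
    unfolding p_def by (rule cInf_greatest) (use that top in auto)
  have "sublinear p"
  proof (rule sublinearI)
    fix g h
    have "p (g + h) - d \<le> p g" if d: "\<forall>\<^sub>F n in sequentially. blinfun_apply h (s n) \<le> d" for d
    proof (rule ge)
      fix c assume "\<forall>\<^sub>F n in sequentially. blinfun_apply g (s n) \<le> c"
      with d have "\<forall>\<^sub>F n in sequentially. blinfun_apply (g + h) (s n) \<le> c + d"
        by eventually_elim (simp add: blinfun.add_left)
      from le[OF this] show "p (g + h) - d \<le> c" by simp
    qed
    then have "p (g + h) - p g \<le> p h"
      by (intro ge) (simp add: algebra_simps)
    then show "p (g + h) \<le> p g + p h" by simp
  next
    show "p 0 = 0"
    proof (rule antisym)
      show "p 0 \<le> 0" by (rule le) simp
      show "0 \<le> p 0" by (rule ge) (use low[of 0] in simp)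
    qed
  next
    fix c :: real and g assume c: "c > 0"
    have "p (c *\<^sub>R g) / c \<le> p g"
    proof (rule ge)
      fix d assume "\<forall>\<^sub>F n in sequentially. blinfun_apply g (s n) \<le> d"
      then have "\<forall>\<^sub>F n in sequentially. blinfun_apply (c *\<^sub>R g) (s n) \<le> c * d"
        by eventually_elim (use c in \<open>simp add: blinfun.scaleR_left\<close>)
      from le[OF this] show "p (c *\<^sub>R g) / c \<le> d" using c by (simp add: field_simps)
    qed
    then show "p (c *\<^sub>R g) \<le> c * p g" using c by (simp add: field_simps)
  qed
  then obtain \<phi> :: "('v \<Rightarrow>\<^sub>L real) \<Rightarrow>\<^sub>L real" where \<phi>: "\<And>g. \<phi> g \<le> p g"
    by (rule hahn_banach_blinfun[where M = M]) (use le[OF top] in auto)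
  obtain w where w: "\<And>g. blinfun_apply \<phi> g = blinfun_apply g w"
    using refl by (auto simp: reflexive_space_def)
  have upper: "blinfun_apply g w \<le> l" if l: "(\<lambda>n. blinfun_apply g (s n)) \<longlonglongrightarrow> l" for g :: "'v \<Rightarrow>\<^sub>L real" and l
  proof (rule field_le_epsilon)
    fix e :: real assume "e > 0"
    then have "\<forall>\<^sub>F n in sequentially. blinfun_apply g (s n) < l + e"
      by (intro order_tendstoD(2)[OF l]) simp
    then have "p g \<le> l + e" by (intro le) (auto elim: eventually_mono)
    then show "blinfun_apply g w \<le> l + e" using \<phi>[of g] w[of g] by simp
  qed
  show ?thesis
  proof (rule that)
    fix g :: "'v \<Rightarrow>\<^sub>L real" and l assume l: "(\<lambda>n. g (s n)) \<longlonglongrightarrow> l"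
    have "(\<lambda>n. (- g) (s n)) \<longlonglongrightarrow> - l"
      using tendsto_minus[OF l] by (simp add: blinfun.minus_left)
    from upper[OF this] upper[OF l] show "g w = l" by (simp add: blinfun.minus_left)
  qed
qed

text \<open>
  The dual space need not be separable, so a diagonal argument over all functionals is unavailable. It
  is carried out only for norming functionals of a countable set that is dense in the span of the
  sequence. Every generalised limit of a further subsequence lies in the closed span, where these
  functionals separate points; so all generalised limits coincide, and the common point is the weak
  limit.
\<close>

theorem reflexive_weak_subsequence:
  fixes s :: "nat \<Rightarrow> 'v::real_normed_vector"
  assumes refl: "reflexive_space TYPE('v)" and bdd: "bounded (range s)"
  obtains r :: "nat \<Rightarrow> nat" and w where "strict_mono r" "(\<lambda>k. s (r k)) \<rightharpoonup> w"
proof -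
  obtain M where M: "\<And>n. norm (s n) \<le> M" using bdd by (auto simp: bounded_iff)
  obtain D where D: "countable D" "span (range s) \<subseteq> closure D"
    by (rule closure_rational_combinations)
  have "\<exists>g :: 'v \<Rightarrow>\<^sub>L real. (\<forall>x. \<bar>g x\<bar> \<le> norm x) \<and> g q = norm q" for q
    by (rule norming_functional[of q]) blast
  then obtain G :: "'v \<Rightarrow> 'v \<Rightarrow>\<^sub>L real"
    where G: "\<And>q x. \<bar>G q x\<bar> \<le> norm x" "\<And>q. G q q = norm q"
    by metis
  obtain r :: "nat \<Rightarrow> nat" where r: "strict_mono r"
    and conv: "\<And>q. q \<in> D \<Longrightarrow> \<exists>l. (\<lambda>k. G q (s (r k))) \<longlonglongrightarrow> l"
    by (rule function_convergent_subsequence[OF D(1), of "\<lambda>n q. G q (s n)" M])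
       (use order_trans[OF G(1) M] that in auto)
  have bdd_sub: "bounded (range (\<lambda>k. s (r (k' k))))" for k' :: "nat \<Rightarrow> nat"
    by (rule bounded_subset[OF bdd]) auto
  \<comment> \<open>Functionals that vanish on the sequence vanish at every generalised limit.\<close>
  have in_span: "w \<in> closure (span (range s))"
    if w: "\<And>(g :: 'v \<Rightarrow>\<^sub>L real) l. (\<lambda>k. blinfun_apply g (s (k' k))) \<longlonglongrightarrow> l \<Longrightarrow> blinfun_apply g w = l" for w and k' :: "nat \<Rightarrow> nat"
  proof (rule ccontr)
    assume "w \<notin> closure (span (range s))"
    then obtain g :: "'v \<Rightarrow>\<^sub>L real" where g: "\<And>x. x \<in> span (range s) \<Longrightarrow> g x = 0" "g w \<noteq> 0"
      using subspace_separation[OF subspace_span] by metis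
    have "(\<lambda>k. blinfun_apply g (s (k' k))) \<longlonglongrightarrow> 0" by (simp add: g(1) span_base)
    from w[OF this] g(2) show False by simp
  qed
  obtain w where w: "\<And>(g :: 'v \<Rightarrow>\<^sub>L real) l. (\<lambda>k. blinfun_apply g (s (r k))) \<longlonglongrightarrow> l \<Longrightarrow> blinfun_apply g w = l"
    using reflexive_generalised_limit[OF refl bdd_sub[of id]] by auto
  \<comment> \<open>On the closed span of the sequence, the countably many functionals already separate points.\<close>
  have uniq: "w' = w"
    if w': "\<And>(g :: 'v \<Rightarrow>\<^sub>L real) l. (\<lambda>k. blinfun_apply g (s (r (k' k)))) \<longlonglongrightarrow> l \<Longrightarrow> blinfun_apply g w' = l"
      and k': "strict_mono k'" for w' and k' :: "nat \<Rightarrow> nat"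
  proof (rule ccontr)
    assume ne: "w' \<noteq> w"
    \<comment> \<open>For \<open>q\<close> close to \<open>y = w' - w\<close>, the functional that norms \<open>q\<close> does not vanish at \<open>y\<close>.\<close>
    define y where "y = w' - w"
    have pos: "norm y > 0" using ne by (simp add: y_def)
    then have eps: "norm y / 8 > 0" by simp
    have "w' \<in> closure (span (range s))" by (rule in_span[of "r \<circ> k'"]) (use w' in simp)
    then obtain a where a: "a \<in> span (range s)" "norm (a - w') < norm y / 8"
      using eps unfolding closure_approachable dist_norm by blast
    have "w \<in> closure (span (range s))" by (rule in_span[OF w])
    then obtain b where b: "b \<in> span (range s)" "norm (b - w) < norm y / 8"
      using eps unfolding closure_approachable dist_norm by blast
    have "a - b \<in> closure D" using D(2) span_diff[OF a(1) b(1)] by blast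
    then obtain q where q: "q \<in> D" "norm (q - (a - b)) < norm y / 8"
      using eps unfolding closure_approachable dist_norm by blast
    have "norm (q - y) = norm ((q - (a - b)) + (a - w') - (b - w))" by (simp add: y_def algebra_simps)
    then have qy: "norm (q - y) < 3 * norm y / 8"
      using norm_triangle_ineq[of "q - (a - b)" "a - w'"]
        norm_triangle_ineq4[of "(q - (a - b)) + (a - w')" "b - w"] a(2) b(2) q(2) by linarith
    obtain l where l: "(\<lambda>k. G q (s (r k))) \<longlonglongrightarrow> l" using conv[OF q(1)] by blast
    have "G q w' = l" using w'[of "G q"] LIMSEQ_subseq_LIMSEQ[OF l k'] by (simp add: o_def)
    then have "G q y = 0" using w[OF l] by (simp add: y_def blinfun.diff_right)
    then have "norm q = G q (q - y)" by (simp add: blinfun.diff_right G(2))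
    then have "norm q \<le> norm (q - y)" using G(1)[of q "q - y"] by simp
    then show False using qy pos norm_triangle_ineq2[of y q] norm_minus_commute[of y q] by linarith
  qed
  have "(\<lambda>k. s (r k)) \<rightharpoonup> w"
    unfolding weakly_converges_def
  proof (intro allI, rule ccontr)
    fix g :: "'v \<Rightarrow>\<^sub>L real" assume "\<not> (\<lambda>k. g (s (r k))) \<longlonglongrightarrow> g w"
    then obtain e where e: "e > 0" "\<exists>\<^sub>F k in sequentially. e \<le> \<bar>g (s (r k)) - g w\<bar>"
      by (auto simp: tendsto_iff dist_real_def frequently_def not_le)
    obtain k1 :: "nat \<Rightarrow> nat" where k1: "strict_mono k1" "\<And>k. e \<le> \<bar>g (s (r (k1 k))) - g w\<bar>"
      by (rule frequently_subsequence[OF e(2)]) blast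
    have "bounded (range (\<lambda>k. g (s (r (k1 k)))))"
      by (rule bounded_linear_image[OF bdd_sub[of k1] blinfun.bounded_linear_right[of g], unfolded image_image])
    then obtain l k2 where k2: "strict_mono (k2::nat \<Rightarrow> nat)" "(\<lambda>k. g (s (r (k1 (k2 k))))) \<longlonglongrightarrow> l"
      using bounded_imp_convergent_subsequence[of "\<lambda>k. g (s (r (k1 k)))"] by (auto simp: o_def)
    obtain w' where w': "\<And>(g :: 'v \<Rightarrow>\<^sub>L real) l. (\<lambda>k. blinfun_apply g (s (r (k1 (k2 k))))) \<longlonglongrightarrow> l \<Longrightarrow> blinfun_apply g w' = l"
      using reflexive_generalised_limit[OF refl bdd_sub[of "k1 \<circ> k2"]] by (auto simp: o_def)
    have "w' = w"
      by (rule uniq[of "k1 \<circ> k2"]) (use w' k1(1) k2(1) in \<open>auto simp: strict_mono_o\<close>)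
    with w'[OF k2(2)] have "l = g w" by simp
    moreover have "e \<le> \<bar>l - g w\<bar>"
      using tendsto_rabs[OF tendsto_diff[OF k2(2) tendsto_const[of "g w"]]] k1(2)
      by (intro LIMSEQ_le_const) auto
    ultimately show False using e(1) by simp
  qed
  with r show ?thesis using that by blast
qed

section \<open>Passing to subsequences\<close>

lemma tendsto_pad_subsequence:
  fixes l :: "'a::topological_space"
  assumes r: "strict_mono (r :: nat \<Rightarrow> nat)" and s: "(\<lambda>k. s (r k)) \<longlonglongrightarrow> l"
  shows "(\<lambda>n. if n \<in> range r then s n else l) \<longlonglongrightarrow> l"
proof (rule topological_tendstoI)
  fix S assume S: "open S" "l \<in> S"
  from topological_tendstoD[OF s S] obtain N where N: "\<And>k. k \<ge> N \<Longrightarrow> s (r k) \<in> S"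
    by (auto simp: eventually_sequentially)
  have "(if n \<in> range r then s n else l) \<in> S" if "n \<ge> r N" for n
    using that N S(2) strict_mono_less_eq[OF r] by auto
  then show "\<forall>\<^sub>F n in sequentially. (if n \<in> range r then s n else l) \<in> S"
    unfolding eventually_sequentially by blast
qed

lemma weakly_converges_pad_subsequence:
  assumes r: "strict_mono (r :: nat \<Rightarrow> nat)" and s: "(\<lambda>k. s (r k)) \<rightharpoonup> w"
  shows "(\<lambda>n. if n \<in> range r then s n else w) \<rightharpoonup> w"
  unfolding weakly_converges_def
proof
  fix g :: "'a \<Rightarrow>\<^sub>L real"
  from tendsto_pad_subsequence[OF r, of "\<lambda>n. g (s n)", OF weakly_convergesD[OF s]]
  show "(\<lambda>n. g (if n \<in> range r then s n else w)) \<longlonglongrightarrow> g w"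
    by (simp add: if_distrib cong: if_cong)
qed

text \<open>
  A condition on full sequences implies the same condition along subsequences: fill the gaps with the
  weak limits.
\<close>

lemma weak_limsup_subsequence:
  fixes J :: "nat \<Rightarrow> 'v::real_normed_vector \<Rightarrow> 'v \<Rightarrow> real"
  assumes J: "\<And>us vs w v. us \<rightharpoonup> w \<Longrightarrow> vs \<rightharpoonup> v \<Longrightarrow>
      limsup (\<lambda>n. ereal (J n (us n) (vs n))) \<le> ereal (J' w v)"
    and r: "strict_mono r"
    and us: "(\<lambda>k. us (r k)) \<rightharpoonup> w" and vs: "(\<lambda>k. vs (r k)) \<rightharpoonup> v" and e: "e > 0"
  shows "\<forall>\<^sub>F k in sequentially. J (r k) (us (r k)) (vs (r k)) < J' w v + e"
proof -
  let ?us = "\<lambda>n. if n \<in> range r then us n else w" and ?vs = "\<lambda>n. if n \<in> range r then vs n else v"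
  have "limsup (\<lambda>n. ereal (J n (?us n) (?vs n))) \<le> ereal (J' w v)"
    by (rule J[OF weakly_converges_pad_subsequence[OF r us] weakly_converges_pad_subsequence[OF r vs]])
  also have "\<dots> < ereal (J' w v + e)" using e by simp
  finally have "\<forall>\<^sub>F n in sequentially. ereal (J n (?us n) (?vs n)) < ereal (J' w v + e)"
    by (rule Limsup_lessD)
  then have "\<forall>\<^sub>F k in sequentially. ereal (J (r k) (?us (r k)) (?vs (r k))) < ereal (J' w v + e)"
    by (rule eventually_subseq[OF r])
  then show ?thesis by simp
qed

section \<open>The variational inequality at a fixed time\<close>

lemma variational_inequality_test:
  fixes a :: "'v::real_normed_vector \<Rightarrow> 'v \<Rightarrow>\<^sub>L real"
  assumes mono: "m * (norm (u - v))\<^sup>2 \<le> (a u - a v) (u - v)"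
    and VI: "c \<le> a u (v - u) + \<phi> v - \<phi> u"
  shows "m * (norm (u - v))\<^sup>2 \<le> a v (v - u) + \<phi> v - \<phi> u - c"
  using mono VI by (simp add: blinfun.diff_left blinfun.diff_right)

text \<open>
  The test point \<open>v\<close> is arbitrary, so a bounded sequence of test points gives a bound on the solutions
  that is affine in the size \<open>X\<close> of the state. The condition \<open>\<delta> < m\<close> makes the bound effective.
\<close>

lemma variational_inequality_a_priori:
  fixes a :: "'v::real_normed_vector \<Rightarrow> 'v \<Rightarrow>\<^sub>L real" and \<pi> :: "'v \<Rightarrow> 'z::real_inner"
  assumes mono: "m * (norm (u - v))\<^sup>2 \<le> (a u - a v) (u - v)"
    and VI: "inner f (\<pi> v - \<pi> u) \<le> a u (v - u) + \<phi> v - \<phi> u"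
    and \<phi>: "\<phi> v - \<phi> u \<le> (\<tau> + \<delta> * (X + norm u)) * norm (v - u)"
    and \<pi>: "norm (\<pi> v - \<pi> u) \<le> P * norm (v - u)"
    and nonneg: "0 \<le> \<tau>" "0 \<le> \<delta>" "0 \<le> X" "0 \<le> P"
  shows "(m - \<delta>) * norm (u - v) \<le> norm (a v) + \<tau> + \<delta> * (X + norm v) + norm f * P"
proof -
  define D where "D = norm (u - v)"
  have D: "norm (v - u) = D" "D \<ge> 0" by (simp_all add: D_def norm_minus_commute)
  have "m * D\<^sup>2 \<le> a v (v - u) + \<phi> v - \<phi> u - inner f (\<pi> v - \<pi> u)"
    unfolding D_def by (rule variational_inequality_test[OF mono VI])
  also have "\<dots> \<le> norm (a v) * D + (\<tau> + \<delta> * (X + norm u)) * D + norm f * (P * D)"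
  proof -
    have "a v (v - u) \<le> norm (a v) * D"
      using norm_blinfun[of "a v" "v - u"] D(1) by simp
    moreover have "- inner f (\<pi> v - \<pi> u) \<le> norm f * (P * D)"
      using Cauchy_Schwarz_ineq2[of f "\<pi> v - \<pi> u"] mult_left_mono[OF \<pi>, of "norm f"] D(1) by simp
    ultimately show ?thesis using \<phi> D(1) by simp
  qed
  also have "\<dots> \<le> (norm (a v) + \<tau> + \<delta> * (X + D + norm v) + norm f * P) * D"
  proof -
    have "norm u \<le> D + norm v" using norm_triangle_ineq[of "u - v" v] by (simp add: D_def)
    then have "\<delta> * (X + norm u) * D \<le> \<delta> * (X + D + norm v) * D"
      using nonneg D(2) by (intro mult_right_mono mult_left_mono) auto
    then show ?thesis by (simp add: algebra_simps)
  qed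
  finally have "((m - \<delta>) * D) * D \<le> (norm (a v) + \<tau> + \<delta> * (X + norm v) + norm f * P) * D"
    by (simp add: power2_eq_square algebra_simps)
  moreover have "0 \<le> norm (a v) + \<tau> + \<delta> * (X + norm v) + norm f * P"
    using nonneg by simp
  ultimately show ?thesis
    using D(2) unfolding D_def[symmetric] by (cases "D = 0") auto
qed

text \<open>
  All data are taken at one fixed time: \<open>xn\<close> and \<open>x\<close> are the states and \<open>un\<close> and \<open>u\<close> the solutions, and
  \<open>a\<close> and \<open>j\<close> are the limiting operator at \<open>(x, u)\<close> and the limiting functional at \<open>x\<close>. The states
  are only bounded, so the conclusion can be inserted into Gronwall's inequality before anything is
  known about their convergence.
\<close>

proposition variational_inequality_stability:
  fixes \<pi> :: "'v::real_normed_vector \<Rightarrow> 'z::real_inner" and An :: "nat \<Rightarrow> 'x::real_normed_vector \<Rightarrow> 'v \<Rightarrow> 'v \<Rightarrow>\<^sub>L real"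
    and jn :: "nat \<Rightarrow> 'x \<Rightarrow> 'v \<Rightarrow> 'v \<Rightarrow> real" and a :: "'v \<Rightarrow>\<^sub>L real" and j :: "'v \<Rightarrow> 'v \<Rightarrow> real"
  assumes refl: "reflexive_space TYPE('v)"
    and \<pi>: "\<And>(vs :: nat \<Rightarrow> 'v) v. vs \<rightharpoonup> v \<Longrightarrow> (\<lambda>n. \<pi> (vs n)) \<longlonglongrightarrow> \<pi> v"
    and K: "mosco_converges Kn K"
    and A_mono: "\<And>n x v1 v2. m * (norm (v1 - v2))\<^sup>2 \<le> (An n x v1 - An n x v2) (v1 - v2)"
    and A_lip: "\<And>n x1 x2 v. norm (An n x1 v - An n x2 v) \<le> L' * norm (x1 - x2)"
    and A_conv: "\<And>vs. vs \<longlonglongrightarrow> u \<Longrightarrow> (\<lambda>n. An n x (vs n)) \<longlonglongrightarrow> a"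
    and jn: "\<And>n x1 x2 w v1 v2. jn n x1 w v2 - jn n x1 w v1 + jn n x2 w v1 - jn n x2 w v2
        \<le> \<alpha> * norm (x1 - x2) * norm (v1 - v2)"
    and j: "\<And>u1 u2 v1 v2. j u1 v2 - j u1 v1 + j u2 v1 - j u2 v2
        \<le> \<beta> * norm (u1 - u2) * norm (v1 - v2)"
    and j_limsup: "\<And>us vs w v. us \<rightharpoonup> w \<Longrightarrow> vs \<rightharpoonup> v \<Longrightarrow>
        limsup (\<lambda>n. ereal (jn n x (us n) (vs n) - jn n x (us n) (us n))) \<le> ereal (j w v - j w w)"
    and const: "0 \<le> L'" "0 \<le> \<alpha>" "0 \<le> \<beta>" "\<beta> < m"
    and f: "fn \<rightharpoonup> f" "bounded (range fn)"
    and bdd: "bounded (range xn)" "bounded (range un)"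
    and u: "u \<in> K" "\<And>v. v \<in> K \<Longrightarrow> inner f (\<pi> v - \<pi> u) \<le> a (v - u) + j u v - j u u"
    and un: "\<And>n. un n \<in> Kn n"
      "\<And>n v. v \<in> Kn n \<Longrightarrow> inner (fn n) (\<pi> v - \<pi> (un n))
          \<le> An n (xn n) (un n) (v - un n) + jn n (xn n) (un n) v - jn n (xn n) (un n) (un n)"
    and e: "e > 0"
  shows "\<forall>\<^sub>F n in sequentially. norm (un n - u) \<le> (L' + \<alpha>) / (m - \<beta>) * norm (xn n - x) + e"
proof (rule ccontr)
  define C where "C = (L' + \<alpha>) / (m - \<beta>)"
  have C: "C * (m - \<beta>) = L' + \<alpha>" "C \<ge> 0" using const by (auto simp: C_def)
  assume "\<not> ?thesis"
  then have "\<exists>\<^sub>F n in sequentially. norm (un n - u) > C * norm (xn n - x) + e"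
    by (simp add: frequently_def not_less C_def)
  then obtain r0 :: "nat \<Rightarrow> nat" where r0: "strict_mono r0"
    "\<And>k. norm (un (r0 k) - u) > C * norm (xn (r0 k) - x) + e"
    by (rule frequently_subsequence) blast
  \<comment> \<open>A subsequence along which \<open>un\<close> converges weakly and both errors converge.\<close>
  obtain r1 :: "nat \<Rightarrow> nat" and w where r1: "strict_mono r1" "(\<lambda>k. un (r0 (r1 k))) \<rightharpoonup> w"
    by (rule reflexive_weak_subsequence[OF refl bounded_subset[OF bdd(2), of "range (\<lambda>k. un (r0 k))"]]) auto
  obtain M1 where M1: "\<And>n. norm (un n) \<le> M1" using bdd(2) by (auto simp: bounded_iff)
  obtain M2 where M2: "\<And>n. norm (xn n) \<le> M2" using bdd(1) by (auto simp: bounded_iff)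
  have "norm (norm (un n - u)) \<le> M1 + norm u" for n
    using norm_triangle_ineq4[of "un n" u] M1[of n] by simp
  then have "bounded (range (\<lambda>k. norm (un (r0 (r1 k)) - u)))" by (auto simp: bounded_iff)
  then obtain r2 :: "nat \<Rightarrow> nat" and d where r2: "strict_mono r2" "(\<lambda>k. norm (un (r0 (r1 (r2 k))) - u)) \<longlonglongrightarrow> d"
    using bounded_imp_convergent_subsequence[of "\<lambda>k. norm (un (r0 (r1 k)) - u)"] by (auto simp: o_def)
  have "norm (norm (xn n - x)) \<le> M2 + norm x" for n
    using norm_triangle_ineq4[of "xn n" x] M2[of n] by simp
  then have "bounded (range (\<lambda>k. norm (xn (r0 (r1 (r2 k))) - x)))" by (auto simp: bounded_iff)
  then obtain r3 :: "nat \<Rightarrow> nat" and c where r3: "strict_mono r3" "(\<lambda>k. norm (xn (r0 (r1 (r2 (r3 k)))) - x)) \<longlonglongrightarrow> c"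
    using bounded_imp_convergent_subsequence[of "\<lambda>k. norm (xn (r0 (r1 (r2 k))) - x)"] by (auto simp: o_def)
  define r where "r = (\<lambda>k. r0 (r1 (r2 (r3 k))))"
  have r: "strict_mono r"
    using strict_mono_o[OF r0(1) strict_mono_o[OF r1(1) strict_mono_o[OF r2(1) r3(1)]]]
    by (simp add: r_def o_def)
  have w: "(\<lambda>k. un (r k)) \<rightharpoonup> w"
    using weakly_converges_subseq[OF r1(2) strict_mono_o[OF r2(1) r3(1)]] by (simp add: r_def o_def)
  have d: "(\<lambda>k. norm (un (r k) - u)) \<longlonglongrightarrow> d"
    using LIMSEQ_subseq_LIMSEQ[OF r2(2) r3(1)] by (simp add: r_def o_def)
  have c: "(\<lambda>k. norm (xn (r k) - x)) \<longlonglongrightarrow> c" using r3(2) by (simp add: r_def)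
  have gap: "C * c + e \<le> d"
    by (rule LIMSEQ_le[OF tendsto_add[OF tendsto_mult_left[OF c] tendsto_const] d])
       (use r0(2) in \<open>auto simp: r_def intro: less_imp_le\<close>)
  have d0: "d \<ge> 0" by (rule LIMSEQ_le_const[OF d]) simp
  have c0: "c \<ge> 0" by (rule LIMSEQ_le_const[OF c]) simp
  have "w \<in> K"
    using conjunct2[OF K[unfolded mosco_converges_def], rule_format, of r "\<lambda>k. un (r k)" w] r un(1) w by simp
  obtain v where v: "\<And>n. v n \<in> Kn n" "v \<longlonglongrightarrow> u"
    using K u(1) unfolding mosco_converges_def by blast
  have vr: "(\<lambda>k. v (r k)) \<longlonglongrightarrow> u" using LIMSEQ_subseq_LIMSEQ[OF v(2) r] by (simp add: o_def)
  \<comment> \<open>Replacing \<open>u\<close> by the admissible test points \<open>v n\<close> does not change the limit of the error.\<close>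
  have dv: "(\<lambda>k. norm (un (r k) - v (r k))) \<longlonglongrightarrow> d"
  proof -
    have lim: "(\<lambda>k. norm (v (r k) - u)) \<longlonglongrightarrow> 0"
      using tendsto_norm[OF tendsto_diff[OF vr tendsto_const[of u]]] by simp
    have "norm (norm (un (r k) - v (r k)) - norm (un (r k) - u)) \<le> norm (v (r k) - u)" for k
      using norm_triangle_ineq3[of "un (r k) - v (r k)" "un (r k) - u"]
        norm_minus_commute[of u "v (r k)"] by simp
    then have "(\<lambda>k. norm (un (r k) - v (r k)) - norm (un (r k) - u)) \<longlonglongrightarrow> 0"
      by (intro Lim_null_comparison[OF always_eventually lim] allI)
    from tendsto_add[OF this d] show ?thesis by simp
  qed
  \<comment> \<open>Moving the state from \<open>xn\<close> to \<open>x\<close> in \<open>An\<close> and in \<open>jn\<close> costs the product of both errors.\<close>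
  let ?low = "\<lambda>k. m * (norm (un (r k) - v (r k)))\<^sup>2 - An (r k) x (v (r k)) (v (r k) - un (r k))
      - (L' + \<alpha>) * norm (xn (r k) - x) * norm (un (r k) - v (r k))
      + inner (fn (r k)) (\<pi> (v (r k)) - \<pi> (un (r k)))"
  have low: "?low k \<le> jn (r k) x (un (r k)) (v (r k)) - jn (r k) x (un (r k)) (un (r k))" for k
  proof -
    let ?n = "r k"
    have "m * (norm (un ?n - v ?n))\<^sup>2 \<le> An ?n (xn ?n) (v ?n) (v ?n - un ?n)
        + jn ?n (xn ?n) (un ?n) (v ?n) - jn ?n (xn ?n) (un ?n) (un ?n) - inner (fn ?n) (\<pi> (v ?n) - \<pi> (un ?n))"
      by (rule variational_inequality_test[OF A_mono un(2)[OF v(1)]])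
    moreover have "(An ?n (xn ?n) (v ?n) - An ?n x (v ?n)) (v ?n - un ?n)
        \<le> L' * norm (xn ?n - x) * norm (un ?n - v ?n)"
    proof -
      have "(An ?n (xn ?n) (v ?n) - An ?n x (v ?n)) (v ?n - un ?n)
          \<le> norm (An ?n (xn ?n) (v ?n) - An ?n x (v ?n)) * norm (v ?n - un ?n)"
        using norm_blinfun[of "An ?n (xn ?n) (v ?n) - An ?n x (v ?n)" "v ?n - un ?n"] by simp
      also have "\<dots> \<le> L' * norm (xn ?n - x) * norm (v ?n - un ?n)"
        by (intro mult_right_mono A_lip) simp
      finally show ?thesis by (simp add: norm_minus_commute)
    qed
    moreover have "jn ?n (xn ?n) (un ?n) (v ?n) - jn ?n (xn ?n) (un ?n) (un ?n)
        + jn ?n x (un ?n) (un ?n) - jn ?n x (un ?n) (v ?n) \<le> \<alpha> * norm (xn ?n - x) * norm (un ?n - v ?n)"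
      by (rule jn)
    ultimately show ?thesis by (simp add: blinfun.diff_left algebra_simps)
  qed
  have An_lim: "(\<lambda>k. An (r k) x (v (r k)) (v (r k) - un (r k))) \<longlonglongrightarrow> a (u - w)"
  proof (rule tendsto_blinfun_apply_weak)
    show "(\<lambda>k. An (r k) x (v (r k))) \<longlonglongrightarrow> a"
      using LIMSEQ_subseq_LIMSEQ[OF A_conv[OF v(2)] r] by (simp add: o_def)
    show "(\<lambda>k. v (r k) - un (r k)) \<rightharpoonup> u - w"
      by (rule weakly_converges_diff[OF tendsto_imp_weakly_converges[OF vr] w])
    have "bounded (range v)" using v(2) by (rule convergent_imp_bounded)
    then obtain M where "\<And>n. norm (v n) \<le> M" by (auto simp: bounded_iff)
    then have "norm (v n - un n) \<le> M + M1" for n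
      using norm_triangle_ineq4[of "v n" "un n"] M1[of n] by (meson add_mono order_trans)
    then show "bounded (range (\<lambda>k. v (r k) - un (r k)))" by (auto simp: bounded_iff)
  qed
  have "bounded (range (\<lambda>k. fn (r k)))" by (rule bounded_subset[OF f(2)]) auto
  then have f_lim: "(\<lambda>k. inner (fn (r k)) (\<pi> (v (r k)) - \<pi> (un (r k)))) \<longlonglongrightarrow> inner f (\<pi> u - \<pi> w)"
    by (intro tendsto_inner_weak weakly_converges_subseq[OF f(1) r] tendsto_diff \<pi> w
        tendsto_imp_weakly_converges[OF vr])
  have "?low \<longlonglongrightarrow> m * d\<^sup>2 - a (u - w) - (L' + \<alpha>) * c * d + inner f (\<pi> u - \<pi> w)"
    by (intro tendsto_add tendsto_diff tendsto_mult tendsto_power tendsto_const dv c An_lim f_lim)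
  then have lim: "m * d\<^sup>2 - a (u - w) - (L' + \<alpha>) * c * d + inner f (\<pi> u - \<pi> w) \<le> j w u - j w w"
  proof (rule field_le_epsilon[OF tendsto_upperbound])
    fix \<eta> :: real assume "\<eta> > 0"
    have "\<forall>\<^sub>F k in sequentially.
        jn (r k) x (un (r k)) (v (r k)) - jn (r k) x (un (r k)) (un (r k)) < j w u - j w w + \<eta>"
      by (rule weak_limsup_subsequence[where J = "\<lambda>n w v. jn n x w v - jn n x w w" and J' = "\<lambda>w v. j w v - j w w",
            OF j_limsup r w tendsto_imp_weakly_converges[OF vr] \<open>\<eta> > 0\<close>])
    then show "\<forall>\<^sub>F k in sequentially. ?low k \<le> j w u - j w w + \<eta>"
      by (rule eventually_mono) (use low in \<open>meson less_imp_le order_trans\<close>)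
  qed simp
  have "norm (w - u) \<le> d"
    by (rule weakly_converges_norm_le[OF weakly_converges_diff[OF w tendsto_imp_weakly_converges[OF tendsto_const]] d])
  then have "\<beta> * norm (u - w) * norm (u - w) \<le> \<beta> * d\<^sup>2"
    using const d0 by (simp add: power2_eq_square norm_minus_commute mult.assoc mult_left_mono mult_mono)
  moreover have "inner f (\<pi> w - \<pi> u) \<le> a (w - u) + j u w - j u u"
    by (rule u(2)[OF \<open>w \<in> K\<close>])
  moreover have "j u w - j u u + j w u - j w w \<le> \<beta> * norm (u - w) * norm (u - w)"
    by (rule j)
  ultimately have "m * d\<^sup>2 \<le> (L' + \<alpha>) * c * d + \<beta> * d\<^sup>2"
    using lim by (simp add: blinfun.diff_right inner_diff_right)
  then have "((m - \<beta>) * d) * d \<le> ((C * (m - \<beta>)) * c) * d"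
    unfolding C(1) by (simp add: power2_eq_square algebra_simps)
  moreover have "d > 0" using gap e C(2) c0 by (smt (verit) mult_nonneg_nonneg)
  ultimately have "(m - \<beta>) * d \<le> (m - \<beta>) * (C * c)" by (simp add: mult_ac)
  then have "d \<le> C * c" using const by simp
  with gap e show False by simp
qed

section \<open>Growth of solutions of differential equations\<close>

text \<open>
  The differential form of Gronwall's inequality for a Banach space valued function, whose norm need not
  be differentiable: the integral majorant \<open>Y\<close> of the norm satisfies \<open>Y' \<le> b Y\<close>, so \<open>Y s exp (- b s)\<close>
  decreases.
\<close>

lemma gronwall_norm_bound:
  fixes x :: "real \<Rightarrow> 'a::banach"
  assumes deriv: "\<And>t. t \<in> {0..T} \<Longrightarrow> (x has_vector_derivative x' t) (at t within {0..T})"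
    and h: "continuous_on {0..T} h" "\<And>t. t \<in> {0..T} \<Longrightarrow> 0 \<le> h t"
    and b: "0 \<le> b"
    and bound: "\<And>t. t \<in> {0..T} \<Longrightarrow> norm (x' t) \<le> h t + b * norm (x t)"
    and T: "0 \<le> T"
  shows "norm (x T) \<le> (norm (x 0) + integral {0..T} h) * exp (b * T)"
proof -
  define a where "a = norm (x 0) + integral {0..T} h"
  define Y where "Y = (\<lambda>s. a + b * integral {0..s} (\<lambda>t. norm (x t)))"
  have "continuous_on {0..T} x"
    unfolding continuous_on_eq_continuous_within using has_vector_derivative_continuous[OF deriv] by blast
  then have cont: "continuous_on {0..T} (\<lambda>t. norm (x t))" by (intro continuous_intros)
  have Y: "norm (x s) \<le> Y s" if s: "s \<in> {0..T}" for s
  proof -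
    have sub: "{0..s} \<subseteq> {0..T}" using s by auto
    have int: "h integrable_on {0..s}" "(\<lambda>t. norm (x t)) integrable_on {0..s}"
      using continuous_on_subset[OF h(1) sub] continuous_on_subset[OF cont sub]
      by (auto intro: integrable_continuous_interval)
    have x': "(x' has_integral (x s - x 0)) {0..s}"
      using s sub by (intro fundamental_theorem_of_calculus) (auto intro: has_vector_derivative_within_subset[OF deriv])
    then have "norm (x s - x 0) = norm (integral {0..s} x')" by (simp add: integral_unique)
    also have "\<dots> \<le> integral {0..s} (\<lambda>t. h t + b * norm (x t))"
      using x' int sub bound
      by (intro integral_norm_bound_integral integrable_add integrable_on_mult_right) auto
    also have "\<dots> = integral {0..s} h + b * integral {0..s} (\<lambda>t. norm (x t))"
      using int by (simp add: integral_add integrable_on_mult_right)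
    also have "integral {0..s} h \<le> integral {0..T} h"
      using h(2) sub int(1) integrable_continuous_interval[OF h(1)] by (intro integral_subset_le) auto
    finally show ?thesis
      using norm_triangle_ineq2[of "x s" "x 0"] by (simp add: Y_def a_def)
  qed
  define G where "G = (\<lambda>s. Y s * exp (- b * s))"
  have G': "(G has_real_derivative b * (norm (x s) - Y s) * exp (- b * s)) (at s within {0..T})"
    if s: "s \<in> {0..T}" for s
    unfolding G_def Y_def
    by (rule derivative_eq_intros integral_has_real_derivative[OF cont s] refl | simp)+
       (simp add: algebra_simps)
  have "G T \<le> G 0"
  proof (rule DERIV_nonpos_imp_decreasing_open[OF T])
    fix s assume s: "0 < s" "s < T"
    then have "at s within {0..T} = at s" by (intro at_within_Icc_at)
    with G'[of s] s have "(G has_real_derivative b * (norm (x s) - Y s) * exp (- b * s)) (at s)" by simp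
    moreover have "b * (norm (x s) - Y s) * exp (- b * s) \<le> 0"
      using Y[of s] s b by (intro mult_nonpos_nonneg mult_nonneg_nonpos) auto
    ultimately show "\<exists>y. (G has_real_derivative y) (at s) \<and> y \<le> 0" by blast
  next
    show "continuous_on {0..T} G"
      unfolding continuous_on_eq_continuous_within using DERIV_continuous[OF G'] by blast
  qed
  then have "Y T \<le> a * exp (b * T)"
    by (simp add: G_def Y_def exp_minus field_simps)
  with Y[of T] T show ?thesis by (simp add: a_def)
qed

section \<open>Convergence of the solutions\<close>

theorem theorem3p1:
  fixes I :: "real set"
    and \<pi> :: "'v::banach \<Rightarrow> 'z::{real_inner, complete_space}"
    and F :: "real \<Rightarrow> 'x::banach \<Rightarrow> 'v \<Rightarrow> 'x"
    and x0 :: 'x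
    and K :: "'v set"
    and A :: "'x \<Rightarrow> 'v \<Rightarrow> 'v \<Rightarrow>\<^sub>L real"
    and j :: "'x \<Rightarrow> 'v \<Rightarrow> 'v \<Rightarrow> real"
    and f :: "real \<Rightarrow> 'z"
    and L :: "real set \<Rightarrow> real"
    and L' L'' m \<alpha> \<beta> :: real
    and Fn :: "nat \<Rightarrow> real \<Rightarrow> 'x \<Rightarrow> 'v \<Rightarrow> 'x"
    and x0n :: "nat \<Rightarrow> 'x"
    and Kn :: "nat \<Rightarrow> 'v set"
    and An :: "nat \<Rightarrow> 'x \<Rightarrow> 'v \<Rightarrow> 'v \<Rightarrow>\<^sub>L real"
    and jn :: "nat \<Rightarrow> 'x \<Rightarrow> 'v \<Rightarrow> 'v \<Rightarrow> real"
    and fn :: "nat \<Rightarrow> real \<Rightarrow> 'z"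
    and Ln :: "nat \<Rightarrow> real set \<Rightarrow> real"
    and Ln' Ln'' mn \<alpha>n \<beta>n :: "nat \<Rightarrow> real"
    and x :: "real \<Rightarrow> 'x" and u :: "real \<Rightarrow> 'v"
    and xn :: "nat \<Rightarrow> real \<Rightarrow> 'x" and un :: "nat \<Rightarrow> real \<Rightarrow> 'v"
  assumes I: "time_interval I"
    and V_reflexive: "reflexive_space TYPE('v)"
    and \<pi>: "bounded_linear \<pi>"
    and adm: "admissible I F K A j f L L' L'' m \<alpha> \<beta>"
    and adm_n: "\<And>n. admissible I (Fn n) (Kn n) (An n) (jn n) (fn n)
                  (Ln n) (Ln' n) (Ln'' n) (mn n) (\<alpha>n n) (\<beta>n n)"
    and h1_L: "\<And>n J. compact J \<Longrightarrow> J \<subseteq> I \<Longrightarrow> Ln n J \<le> L J"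
    and h1: "\<And>n. Ln' n \<le> L' \<and> Ln'' n \<le> L'' \<and> mn n \<ge> m \<and> \<alpha>n n \<le> \<alpha> \<and> \<beta>n n \<le> \<beta>"
    and h2: "\<exists>\<Gamma> \<gamma> :: nat \<Rightarrow> real.
               (\<forall>n. \<Gamma> n \<ge> 0 \<and> \<gamma> n \<ge> 0 \<and>
                  (\<forall>t\<in>I. \<forall>y w. norm (Fn n t y w - F t y w) \<le> \<Gamma> n * (norm y + norm w + \<gamma> n))) \<and>
               \<Gamma> \<longlonglongrightarrow> 0 \<and> bounded (range \<gamma>)"
    and h3: "x0n \<longlonglongrightarrow> x0"
    and h4: "mosco_converges Kn K"
    and h5: "\<exists>\<Lambda> l :: nat \<Rightarrow> real.
               (\<forall>n. \<Lambda> n \<ge> 0 \<and> l n \<ge> 0 \<and>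
                  (\<forall>y w. norm (An n y w - A y w) \<le> \<Lambda> n * (norm y + norm w + l n))) \<and>
               \<Lambda> \<longlonglongrightarrow> 0 \<and> bounded (range l)"
    and h6_ab: "\<exists>\<tau> \<delta> :: nat \<Rightarrow> real.
               (\<forall>n. \<tau> n \<ge> 0 \<and> \<delta> n \<ge> 0 \<and>
                  (\<forall>y w v1 v2. jn n y w v1 - jn n y w v2
                     \<le> (\<tau> n + \<delta> n * (norm y + norm w)) * norm (v1 - v2))) \<and>
               (\<exists>\<tau>0>0. \<exists>\<delta>0>0. \<delta>0 < m \<and> (\<forall>n. \<tau> n \<le> \<tau>0 \<and> \<delta> n \<le> \<delta>0))"
    and h6_c: "\<And>(us :: nat \<Rightarrow> 'v) (vs :: nat \<Rightarrow> 'v) w v y. us \<rightharpoonup> w \<Longrightarrow> vs \<rightharpoonup> v \<Longrightarrow>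
               limsup (\<lambda>n. ereal (jn n y (us n) (vs n) - jn n y (us n) (us n)))
                 \<le> ereal (j y w v - j y w w)"
    and h7_a: "\<And>t. t \<in> I \<Longrightarrow> (\<lambda>n. fn n t) \<rightharpoonup> f t"
    and h7_b: "\<And>J. compact J \<Longrightarrow> J \<subseteq> I \<Longrightarrow> \<exists>w>0. \<forall>n. \<forall>t\<in>J. norm (fn n t) \<le> w"
    and h8: "\<And>(vs :: nat \<Rightarrow> 'v) v. vs \<rightharpoonup> v \<Longrightarrow> (\<lambda>n. \<pi> (vs n)) \<longlonglongrightarrow> \<pi> v"
    and sol: "solves_P I \<pi> F x0 K A j f x u"
    and sol_n: "\<And>n. solves_P I \<pi> (Fn n) (x0n n) (Kn n) (An n) (jn n) (fn n) (xn n) (un n)"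
  shows "\<forall>t\<in>I. (\<lambda>n. un n t) \<longlonglongrightarrow> u t \<and> (\<lambda>n. xn n t) \<longlonglongrightarrow> x t"
proof
  fix T assume "T \<in> I"
  define J where "J = {0..T}"
  have T: "T \<ge> 0" and J: "compact J" "J \<subseteq> I" "T \<in> J"
    using I \<open>T \<in> I\<close> by (auto simp: time_interval_def J_def)
  note adm' = adm[unfolded admissible_def]
  have pos: "0 < L J" "0 < L'" "0 < L''" "0 < m" "0 < \<alpha>" "0 < \<beta>" "\<beta> < m"
    using adm' J(1,2) by simp_all
  have F_cont: "continuous_on I (\<lambda>t. F t y w)" for y w
    using adm' by simp
  have F_lip: "norm (F t y1 w1 - F t y2 w2) \<le> L J * (norm (y1 - y2) + norm (w1 - w2))"
    if "t \<in> J" for t y1 y2 w1 w2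
    using adm' J(1,2) that by simp
  have "K \<noteq> {}" using adm' by simp
  have A_lip: "norm (A y w1 - A y w2) \<le> L'' * norm (w1 - w2)" for y w1 w2
    using adm' by simp
  have j: "j y1 w1 v2 - j y1 w1 v1 + j y2 w2 v1 - j y2 w2 v2
      \<le> \<alpha> * norm (y1 - y2) * norm (v1 - v2) + \<beta> * norm (w1 - w2) * norm (v1 - v2)"
    for y1 y2 w1 w2 v1 v2
    using adm' by simp
  note adm_n' = adm_n[unfolded admissible_def]
  have An_lip': "norm (An n y1 w - An n y2 w) \<le> Ln' n * norm (y1 - y2)" for n y1 y2 w
    using adm_n'[of n] by simp
  have An_mono': "mn n * (norm (v1 - v2))\<^sup>2 \<le> (An n y v1 - An n y v2) (v1 - v2)" for n y v1 v2
    using adm_n'[of n] by simp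
  have jn': "jn n y1 w1 v2 - jn n y1 w1 v1 + jn n y2 w2 v1 - jn n y2 w2 v2
      \<le> \<alpha>n n * norm (y1 - y2) * norm (v1 - v2) + \<beta>n n * norm (w1 - w2) * norm (v1 - v2)"
    for n y1 y2 w1 w2 v1 v2
    using adm_n'[of n] by simp
  have An_lip: "norm (An n y1 w - An n y2 w) \<le> L' * norm (y1 - y2)" for n y1 y2 w
    using An_lip'[of n y1 w y2] mult_right_mono[of "Ln' n" L' "norm (y1 - y2)"] h1[of n] by force
  have An_mono: "m * (norm (v1 - v2))\<^sup>2 \<le> (An n y v1 - An n y v2) (v1 - v2)" for n y v1 v2
    using An_mono'[of n v1 v2 y] mult_right_mono[of m "mn n" "(norm (v1 - v2))\<^sup>2"] h1[of n] by force
  have jn: "jn n y1 w v2 - jn n y1 w v1 + jn n y2 w v1 - jn n y2 w v2 \<le> \<alpha> * norm (y1 - y2) * norm (v1 - v2)"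
    for n y1 y2 w v1 v2
    using jn'[of n y1 w v2 v1 y2 w] h1[of n]
      mult_right_mono[of "\<alpha>n n" \<alpha> "norm (y1 - y2) * norm (v1 - v2)"] by (force simp: mult.assoc)
  obtain \<Gamma> \<gamma> where Fn: "\<And>n. \<Gamma> n \<ge> 0" "\<And>n t y w. t \<in> I \<Longrightarrow>
      norm (Fn n t y w - F t y w) \<le> \<Gamma> n * (norm y + norm w + \<gamma> n)"
    and \<Gamma>: "\<Gamma> \<longlonglongrightarrow> 0" and \<gamma>: "bounded (range \<gamma>)"
    using h2 by blast
  obtain \<Lambda> l where An: "\<And>n. \<Lambda> n \<ge> 0" "\<And>n y w. norm (An n y w - A y w) \<le> \<Lambda> n * (norm y + norm w + l n)"
    and \<Lambda>: "\<Lambda> \<longlonglongrightarrow> 0" and l: "bounded (range l)"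
    using h5 by blast
  obtain \<tau> \<delta> \<tau>0 \<delta>0 where jn_lip: "\<And>n y w v1 v2. jn n y w v1 - jn n y w v2
      \<le> (\<tau> n + \<delta> n * (norm y + norm w)) * norm (v1 - v2)"
    and \<tau>\<delta>: "\<And>n. \<tau> n \<le> \<tau>0" "\<And>n. \<delta> n \<le> \<delta>0" "\<tau>0 > 0" "\<delta>0 > 0" "\<delta>0 < m"
    using h6_ab by blast
  obtain G where G: "\<And>n. \<Gamma> n \<le> G" "0 \<le> G"
    using convergent_imp_bounded[OF \<Gamma>] by (auto simp: bounded_iff dest: abs_le_D1) (meson abs_ge_zero abs_le_D1 order_trans)
  obtain g where g: "\<And>n. \<gamma> n \<le> g" "0 \<le> g"
    using \<gamma> by (auto simp: bounded_iff) (meson abs_ge_zero abs_le_D1 order_trans)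
  obtain l0 where l0: "\<And>n. l n \<le> l0"
    using l by (auto simp: bounded_iff) (meson abs_le_D1)
  obtain W where W: "W > 0" "\<And>n t. t \<in> J \<Longrightarrow> norm (fn n t) \<le> W"
    using h7_b[OF J(1,2)] by blast
  obtain P where P: "P > 0" "\<And>v. norm (\<pi> v) \<le> norm v * P"
    using bounded_linear.pos_bounded[OF \<pi>] by blast
  have \<pi>_le: "norm (\<pi> v - \<pi> w) \<le> P * norm (v - w)" for v w
    using P(2)[of "v - w"] bounded_linear.linear[OF \<pi>] by (simp add: linear_diff mult.commute)
  have An_conv: "(\<lambda>n. An n y (vs n)) \<longlonglongrightarrow> A y v" if v: "vs \<longlonglongrightarrow> v" for y vs v
  proof -
    obtain M where M: "\<And>n. norm (vs n) \<le> M"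
      using convergent_imp_bounded[OF v] by (auto simp: bounded_iff)
    have "norm (An n y (vs n) - A y v) \<le> \<Lambda> n * (norm y + M + l0) + L'' * norm (vs n - v)" for n
    proof -
      have "norm (An n y (vs n) - A y (vs n)) \<le> \<Lambda> n * (norm y + M + l0)"
        using An(2)[of n y "vs n"] mult_left_mono[OF _ An(1), of "norm y + norm (vs n) + l n" "norm y + M + l0" n]
          M[of n] l0[of n] by force
      then show ?thesis
        using A_lip[of y "vs n" v] norm_triangle_ineq[of "An n y (vs n) - A y (vs n)" "A y (vs n) - A y v"]
        by simp
    qed
    moreover have "(\<lambda>n. \<Lambda> n * (norm y + M + l0) + L'' * norm (vs n - v)) \<longlonglongrightarrow> 0 * (norm y + M + l0) + L'' * norm (v - v)"
      by (intro tendsto_intros \<Lambda> v)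
    then have lim: "(\<lambda>n. \<Lambda> n * (norm y + M + l0) + L'' * norm (vs n - v)) \<longlonglongrightarrow> 0" by simp
    ultimately have "(\<lambda>n. An n y (vs n) - A y v) \<longlonglongrightarrow> 0"
      by (intro Lim_null_comparison[OF always_eventually lim] allI)
    then show ?thesis by (simp add: LIM_zero_iff)
  qed
  from sol have x': "\<And>t. t \<in> I \<Longrightarrow> (x has_vector_derivative F t (x t) (u t)) (at t within I)"
    and u_cont: "continuous_on I u" and x0: "x 0 = x0" and u_K: "\<And>t. t \<in> I \<Longrightarrow> u t \<in> K"
    and VI: "\<And>t v. t \<in> I \<Longrightarrow> v \<in> K \<Longrightarrow>
      inner (f t) (\<pi> v - \<pi> (u t)) \<le> A (x t) (u t) (v - u t) + j (x t) (u t) v - j (x t) (u t) (u t)"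
    unfolding solves_P_def by auto
  note sol_n' = sol_n[unfolded solves_P_def]
  have xn': "(xn n has_vector_derivative Fn n t (xn n t) (un n t)) (at t within I)" if "t \<in> I" for n t
    using sol_n'[of n] that by blast
  have un_K: "un n t \<in> Kn n" if "t \<in> I" for n t
    using sol_n'[of n] that by blast
  have VIn: "inner (fn n t) (\<pi> v - \<pi> (un n t))
      \<le> An n (xn n t) (un n t) (v - un n t) + jn n (xn n t) (un n t) v - jn n (xn n t) (un n t) (un n t)"
    if "t \<in> I" "v \<in> Kn n" for n t v
    using sol_n'[of n] that by blast
  have un_cont: "continuous_on I (un n)" and xn0: "xn n 0 = x0n n" for n
    using sol_n'[of n] by auto

  \<comment> \<open>A priori bounds on \<open>J\<close>, uniform in \<open>n\<close>: test with approximations \<open>v n\<close> of a point of \<open>K\<close>.\<close>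
  obtain v0 where "v0 \<in> K" using \<open>K \<noteq> {}\<close> by auto
  then obtain v where v: "\<And>n. v n \<in> Kn n" "v \<longlonglongrightarrow> v0"
    using h4 unfolding mosco_converges_def by blast
  obtain V where V: "\<And>n. norm (v n) \<le> V"
    using convergent_imp_bounded[OF v(2)] by (auto simp: bounded_iff)
  obtain a where a: "\<And>n. norm (An n 0 (v n)) \<le> a"
    using convergent_imp_bounded[OF An_conv[OF v(2)], of 0] by (auto simp: bounded_iff)
  define c where "c = (L' + \<delta>0) / (m - \<delta>0)"
  define C where "C = (a + \<tau>0 + \<delta>0 * V + W * P) / (m - \<delta>0) + V"
  have "c \<ge> 0" using pos \<tau>\<delta> by (simp add: c_def)
  have u_le: "norm (un n t) \<le> c * norm (xn n t) + C" if t: "t \<in> J" for n t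
  proof -
    have tI: "t \<in> I" using t J by auto
    have "(m - \<delta>0) * norm (un n t - v n) \<le> norm (An n (xn n t) (v n)) + \<tau>0
        + \<delta>0 * (norm (xn n t) + norm (v n)) + norm (fn n t) * P"
    proof (rule variational_inequality_a_priori[OF An_mono VIn[OF tI v(1)]])
      have "(\<tau> n + \<delta> n * (norm (xn n t) + norm (un n t))) * norm (v n - un n t)
          \<le> (\<tau>0 + \<delta>0 * (norm (xn n t) + norm (un n t))) * norm (v n - un n t)"
        using \<tau>\<delta> by (intro mult_right_mono add_mono) auto
      with jn_lip[of n "xn n t" "un n t" "v n" "un n t"]
      show "jn n (xn n t) (un n t) (v n) - jn n (xn n t) (un n t) (un n t)
          \<le> (\<tau>0 + \<delta>0 * (norm (xn n t) + norm (un n t))) * norm (v n - un n t)"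
        by simp
    qed (use \<pi>_le P \<tau>\<delta> in auto)
    also have "\<dots> \<le> (a + L' * norm (xn n t)) + \<tau>0 + \<delta>0 * (norm (xn n t) + V) + W * P"
    proof (intro add_mono mult_left_mono mult_right_mono V W t order_refl)
      show "norm (An n (xn n t) (v n)) \<le> a + L' * norm (xn n t)"
        using An_lip[of n "xn n t" "v n" 0] a[of n]
          norm_triangle_ineq2[of "An n (xn n t) (v n)" "An n 0 (v n)"] by simp
    qed (use \<tau>\<delta> P in auto)
    finally have "norm (un n t - v n) * (m - \<delta>0) \<le> (L' + \<delta>0) * norm (xn n t) + (a + \<tau>0 + \<delta>0 * V + W * P)"
      by (simp add: algebra_simps)
    then have "norm (un n t - v n) \<le> c * norm (xn n t) + (a + \<tau>0 + \<delta>0 * V + W * P) / (m - \<delta>0)"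
      using \<tau>\<delta>(5) by (simp add: c_def pos_le_divide_eq[symmetric] add_divide_distrib distrib_right)
    then show ?thesis
      using norm_triangle_ineq[of "un n t - v n" "v n"] V[of n] by (simp add: C_def)
  qed
  have "bounded ((\<lambda>t. F t 0 0) ` J)"
    by (rule compact_imp_bounded[OF compact_continuous_image[OF continuous_on_subset[OF F_cont J(2)] J(1)]])
  then obtain F0 where F0: "\<And>t. t \<in> J \<Longrightarrow> norm (F t 0 0) \<le> F0"
    by (auto simp: bounded_iff)
  have F0_nonneg: "0 \<le> F0" using F0[OF J(3)] norm_ge_zero order_trans by blast
  obtain X0 where X0: "\<And>n. norm (x0n n) \<le> X0"
    using convergent_imp_bounded[OF h3] by (auto simp: bounded_iff)
  define B where "B = (G + L J) * (1 + c)"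
  \<comment> \<open>The absolute value makes \<open>H\<close> a nonnegative forcing term whatever the sign of \<open>C\<close>.\<close>
  define H where "H = \<bar>(G + L J) * C + G * g + F0\<bar>"
  have B0: "B \<ge> 0" using G pos \<open>c \<ge> 0\<close> by (simp add: B_def)
  define X where "X = (X0 + T * H) * exp (B * T)"
  have x_le: "norm (xn n t) \<le> X" if t: "t \<in> J" for n t
  proof -
    have sub: "{0..t} \<subseteq> J" and t0: "0 \<le> t" "t \<le> T" using t by (auto simp: J_def)
    have "norm (xn n t) \<le> (norm (xn n 0) + integral {0..t} (\<lambda>s. H)) * exp (B * t)"
    proof (rule gronwall_norm_bound[where x' = "\<lambda>s. Fn n s (xn n s) (un n s)"])
      fix s assume s: "s \<in> {0..t}"
      then have sJ: "s \<in> J" and sI: "s \<in> I" using sub J by auto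
      show "(xn n has_vector_derivative Fn n s (xn n s) (un n s)) (at s within {0..t})"
        by (rule has_vector_derivative_within_subset[OF xn'[OF sI]]) (use sub J in auto)
      let ?S = "norm (xn n s) + norm (un n s)"
      have "norm (Fn n s (xn n s) (un n s) - F s (xn n s) (un n s)) \<le> \<Gamma> n * (?S + \<gamma> n)"
        using Fn(2)[OF sI] by simp
      also have "\<dots> \<le> \<Gamma> n * (?S + g)"
        by (intro mult_left_mono add_mono g Fn(1) order_refl)
      also have "\<dots> \<le> G * (?S + g)"
        by (intro mult_right_mono G) (use g in auto)
      finally have "norm (Fn n s (xn n s) (un n s)) \<le> G * (?S + g) + L J * ?S + F0"
        using F_lip[OF sJ, of "xn n s" "un n s" 0 0] F0[OF sJ]
          norm_triangle_ineq2[of "Fn n s (xn n s) (un n s)" "F s (xn n s) (un n s)"]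
          norm_triangle_ineq2[of "F s (xn n s) (un n s)" "F s 0 0"] by simp
      also have "\<dots> = (G + L J) * ?S + G * g + F0" by (simp add: algebra_simps)
      also have "\<dots> \<le> (G + L J) * (norm (xn n s) + (c * norm (xn n s) + C)) + G * g + F0"
        using u_le[OF sJ, of n] G pos by (intro add_mono mult_left_mono) auto
      also have "\<dots> = B * norm (xn n s) + ((G + L J) * C + G * g + F0)"
        by (simp add: B_def algebra_simps)
      finally show "norm (Fn n s (xn n s) (un n s)) \<le> H + B * norm (xn n s)"
        by (simp add: H_def)
    qed (use t0 B0 in \<open>auto simp: H_def\<close>)
    also have "\<dots> \<le> X"
      unfolding X_def using X0[of n] t0 B0 order_trans[OF norm_ge_zero X0[of n]] T
      by (intro mult_mono add_mono) (auto simp: xn0 H_def intro!: mult_right_mono mult_left_mono add_nonneg_nonneg)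
    finally show ?thesis .
  qed
  define M where "M = X + (c * X + C)"
  have sum_le: "norm (xn n t) + norm (un n t) \<le> M" if "t \<in> J" for n t
    using x_le[OF that, of n] u_le[OF that, of n] mult_left_mono[OF x_le[OF that, of n] \<open>c \<ge> 0\<close>]
    by (simp add: M_def)

  \<comment> \<open>The part of the control error that the state error does not explain.\<close>
  define D where "D = (L' + \<alpha>) / (m - \<beta>)"
  have D0: "D \<ge> 0" using pos by (simp add: D_def)
  define \<epsilon> where "\<epsilon> = (\<lambda>n t. max 0 (norm (un n t - u t) - D * norm (xn n t - x t)))"
  have u_err: "norm (un n t - u t) \<le> D * norm (xn n t - x t) + \<epsilon> n t" for n t
    by (simp add: \<epsilon>_def max_def)
  have \<epsilon>_lim: "(\<lambda>n. \<epsilon> n t) \<longlonglongrightarrow> 0" if t: "t \<in> J" for t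
  proof (rule tendstoI)
    fix e :: real assume e: "e > 0"
    have tI: "t \<in> I" using t J by auto
    have bdd: "bounded (range (\<lambda>n. xn n t))" "bounded (range (\<lambda>n. un n t))" "bounded (range (\<lambda>n. fn n t))"
      using x_le[OF t] W(2)[OF t] sum_le[OF t] norm_ge_zero[of "xn _ t"]
      by (auto simp: bounded_iff) (meson add_increasing norm_ge_zero order_trans order_refl)
    have "\<forall>\<^sub>F n in sequentially. norm (un n t - u t) \<le> (L' + \<alpha>) / (m - \<beta>) * norm (xn n t - x t) + e / 2"
    proof (rule variational_inequality_stability[OF V_reflexive h8 h4 An_mono An_lip An_conv jn
          _ h6_c _ _ _ _ h7_a[OF tI] bdd(3) bdd(1,2) u_K[OF tI] _ un_K[OF tI]])
      show "j (x t) w1 v2 - j (x t) w1 v1 + j (x t) w2 v1 - j (x t) w2 v2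
          \<le> \<beta> * norm (w1 - w2) * norm (v1 - v2)" for w1 w2 v1 v2
        using j[of "x t" w1 v2 v1 "x t" w2] by simp
    qed (use pos e VI[OF tI] VIn[OF tI] in auto)
    then show "\<forall>\<^sub>F n in sequentially. dist (\<epsilon> n t) 0 < e"
      by eventually_elim (use e in \<open>auto simp: \<epsilon>_def D_def dist_real_def\<close>)
  qed
  have x_cont: "continuous_on I x"
    unfolding continuous_on_eq_continuous_within using has_vector_derivative_continuous[OF x'] by blast
  have xn_cont: "continuous_on I (xn n)" for n
    unfolding continuous_on_eq_continuous_within using has_vector_derivative_continuous[OF xn'] by blast
  have \<epsilon>_cont: "continuous_on J (\<epsilon> n)" for n
    unfolding \<epsilon>_def
    by (intro continuous_intros continuous_on_subset[OF _ J(2)] u_cont un_cont x_cont xn_cont)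
  have \<epsilon>_le: "\<epsilon> n t \<le> M + norm (u t)" if "t \<in> J" for n t
  proof -
    have "norm (un n t - u t) \<le> M + norm (u t)"
      using norm_triangle_ineq4[of "un n t" "u t"] sum_le[OF that, of n] norm_ge_zero[of "xn n t"] by linarith
    then show ?thesis using D0 by (auto simp: \<epsilon>_def max_def intro: order_trans[rotated])
  qed
  have \<epsilon>_int: "(\<lambda>n. integral J (\<epsilon> n)) \<longlonglongrightarrow> integral J (\<lambda>t. 0 :: real)"
  proof (rule dominated_convergence(2))
    show "\<epsilon> n integrable_on J" for n
      using \<epsilon>_cont[of n] by (auto simp: J_def intro: integrable_continuous_interval)
    show "(\<lambda>t. M + norm (u t)) integrable_on J"
      using continuous_on_subset[OF u_cont J(2)] unfolding J_def
      by (intro integrable_continuous_interval continuous_intros)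
    show "norm (\<epsilon> n t) \<le> M + norm (u t)" if "t \<in> J" for n t
      using \<epsilon>_le[OF that, of n] by (simp add: \<epsilon>_def)
  qed (use \<epsilon>_lim in auto)

  \<comment> \<open>Inserting \<open>u_err\<close> into the Lipschitz bound for \<open>F\<close> leaves \<open>\<epsilon>\<close> as a forcing term only.\<close>
  define b where "b = L J * (1 + D)"
  have b0: "b \<ge> 0" using pos D0 by (simp add: b_def)
  have M0: "M \<ge> 0" using sum_le[OF J(3), of 0] norm_ge_zero by (meson add_nonneg_nonneg order_trans)
  have x_err: "norm (xn n T - x T) \<le> (norm (x0n n - x0) + (\<Gamma> n * (M + g) * T + L J * integral J (\<epsilon> n))) * exp (b * T)" for n
  proof -
    let ?h = "\<lambda>s. \<Gamma> n * (M + g) + L J * \<epsilon> n s"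
    have "norm (xn n T - x T) \<le> (norm (xn n 0 - x 0) + integral {0..T} ?h) * exp (b * T)"
    proof (rule gronwall_norm_bound[where x = "\<lambda>s. xn n s - x s"
          and x' = "\<lambda>s. Fn n s (xn n s) (un n s) - F s (x s) (u s)"])
      fix s assume "s \<in> {0..T}"
      then have sJ: "s \<in> J" and sI: "s \<in> I" using J by (auto simp: J_def)
      show "((\<lambda>s. xn n s - x s) has_vector_derivative Fn n s (xn n s) (un n s) - F s (x s) (u s)) (at s within {0..T})"
        using J(2) unfolding J_def
        by (intro has_vector_derivative_diff has_vector_derivative_within_subset[OF xn'[OF sI]]
            has_vector_derivative_within_subset[OF x'[OF sI]])
      show "0 \<le> ?h s"
        using Fn(1) M0 g pos by (intro add_nonneg_nonneg mult_nonneg_nonneg) (auto simp: \<epsilon>_def)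
      have "norm (Fn n s (xn n s) (un n s) - F s (xn n s) (un n s)) \<le> \<Gamma> n * (M + g)"
        using Fn(2)[OF sI, of n "xn n s" "un n s"] sum_le[OF sJ, of n] g(1)[of n]
          mult_left_mono[OF _ Fn(1), of "norm (xn n s) + norm (un n s) + \<gamma> n" "M + g" n] by force
      moreover have "norm (F s (xn n s) (un n s) - F s (x s) (u s))
          \<le> L J * (norm (xn n s - x s) + (D * norm (xn n s - x s) + \<epsilon> n s))"
        using order_trans[OF F_lip[OF sJ, of "xn n s" "un n s" "x s" "u s"] mult_left_mono[OF add_left_mono[OF u_err]]] pos
        by simp
      ultimately show "norm (Fn n s (xn n s) (un n s) - F s (x s) (u s)) \<le> ?h s + b * norm (xn n s - x s)"
        using norm_triangle_ineq[of "Fn n s (xn n s) (un n s) - F s (xn n s) (un n s)"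
            "F s (xn n s) (un n s) - F s (x s) (u s)"]
        by (simp add: b_def algebra_simps)
    next
      show "continuous_on {0..T} ?h"
        using \<epsilon>_cont[of n] unfolding J_def by (intro continuous_intros)
    qed (use b0 T in auto)
    also have "integral {0..T} ?h = \<Gamma> n * (M + g) * T + L J * integral J (\<epsilon> n)"
    proof -
      have "(\<lambda>s. L J * \<epsilon> n s) integrable_on {0..T}"
        using \<epsilon>_cont[of n] unfolding J_def by (intro integrable_continuous_interval continuous_intros)
      from integral_add[OF integrable_const_ivl this, of "\<Gamma> n * (M + g)"] show ?thesis
        using T by (simp add: J_def mult.commute[of _ T])
    qed
    finally show ?thesis by (simp add: xn0 x0)
  qed
  have "(\<lambda>n. (norm (x0n n - x0) + (\<Gamma> n * (M + g) * T + L J * integral J (\<epsilon> n))) * exp (b * T))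
      \<longlonglongrightarrow> (norm (x0 - x0) + (0 * (M + g) * T + L J * integral J (\<lambda>t. 0 :: real))) * exp (b * T)"
    by (intro tendsto_intros h3 \<Gamma> \<epsilon>_int)
  then have "(\<lambda>n. (norm (x0n n - x0) + (\<Gamma> n * (M + g) * T + L J * integral J (\<epsilon> n))) * exp (b * T)) \<longlonglongrightarrow> 0"
    by simp
  then have "(\<lambda>n. xn n T - x T) \<longlonglongrightarrow> 0"
    by (rule Lim_null_comparison[OF always_eventually, rotated]) (rule allI x_err)+
  then have x_lim: "(\<lambda>n. xn n T) \<longlonglongrightarrow> x T" by (simp add: LIM_zero_iff)
  have "(\<lambda>n. D * norm (xn n T - x T) + \<epsilon> n T) \<longlonglongrightarrow> D * norm (x T - x T) + 0"
    by (intro tendsto_intros x_lim \<epsilon>_lim J(3))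
  then have "(\<lambda>n. D * norm (xn n T - x T) + \<epsilon> n T) \<longlonglongrightarrow> 0" by simp
  then have "(\<lambda>n. un n T - u T) \<longlonglongrightarrow> 0"
    by (rule Lim_null_comparison[OF always_eventually, rotated]) (rule allI u_err)+
  then show "(\<lambda>n. un n T) \<longlonglongrightarrow> u T \<and> (\<lambda>n. xn n T) \<longlonglongrightarrow> x T"
    using x_lim by (simp add: LIM_zero_iff)
qed

end
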